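(* Let $\mathcal U$ be a $\mathsf{\Lambda}$-upper cluster algebra of type $S$ and let $u,u'\in\mathcal U$ be two good elements. Let $w\in\mathbb T_n$ be any vertex and let $$u=\mathbf x_w^{\mathbf g_u^w}F_u^w(\hat y_{1;w},\ldots,\hat y_{n;w}),\qquad u'=\mathbf x_w^{\mathbf g_{u'}^w}F_{u'}^w(\hat y_{1;w},\ldots,\hat y_{n;w})$$ be the canonical expressions of $u$ and $u'$ with respect to $w$. Then: (i) $\langle u,u'\rangle_{\rm trop}=(\mathbf g_u^w)^T\Lambda_w\mathbf g_{u'}^w+F_u^w[(S\mid\mathbf 0)\mathbf g_{u'}^w]$. (ii) $(u\mid\mid u')_F=F_u^w[(S\mid\mathbf 0)\mathbf g_{u'}^w]+F_{u'}^w[(S\mid\mathbf 0)\mathbf g_u^w]$. In particular $(u\mid\mid u')_F\in\mathbb Z_{\ge 0}$. (iii) $(u\mid\mid u)_F=0$ whenever $u$ is a cluster monomial.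
   Context: Fix integers $m\ge n>0$; $[1,r]=\{1,\dots,r\}$, $[a]_+=\max\{a,0\}$. Vectors are columns; matrices are integral. Seeds. A mutation matrix is an $m\times n$ matrix $\widetilde B=(b_{ij})$ whose top $n\times n$ block $B$ is skew-symmetrizable (there is a diagonal matrix $S$ with positive integer diagonal entries such that $SB$ is skew-symmetric; $S$ is a skew-symmetrizer). For $k\in[1,n]$, $\mu_k(\widetilde B)=(b'_{ij})$ with $b'_{ij}=-b_{ij}$ if $i=k$ or $j=k$, and $b'_{ij}=b_{ij}+[b_{ik}]_+[b_{kj}]_+-[-b_{ik}]_+[-b_{kj}]_+$ otherwise. Let $\mathbb F$ be the field of rational functions over $\mathbb Q$ in $m$ variables. A seed is $(\mathbf x,\widetilde B)$ with $\mathbf x=(x_1,\dots,x_m)$ a free generating set of $\mathbb F$ over $\mathbb Q$ and $\widetilde B$ a mutation matrix; $x_1,\dots,x_n$ are unfrozen and $x_{n+1},\dots,x_m$ frozen cluster variables. Its mutation $\mu_k(\mathbf x,\widetilde B)=(\mathbf x',\mu_k(\widetilde B))$ has $x_i'=x_i$ for $i\ne k$ and $x_kx_k'=\prod_jx_j^{[b_{jk}]_+}+\prod_jx_j^{[-b_{jk}]_+}$. $\mathbb T_n$ is the $n$-regular tree with edges labelled by $1,\dots,n$ so that the edges at each vertex have distinct labels, with root $t_0$. A cluster pattern assigns to each $t\in\mathbb T_n$ a seed $(\mathbf x_t,\widetilde B_t)$, with seeds at the ends of an edge labelled $k$ related by $\mu_k$. Write $\mathbf x_t=(x_{1;t},\dots,x_{m;t})$,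 $\widetilde B_t=(b_{ij;t})$, $\hat y_{k;t}=\prod_{j=1}^mx_{j;t}^{b_{jk;t}}$. The upper cluster algebra is $\mathcal U=\bigcap_{t}\mathbb Z[x_{1;t}^{\pm1},\dots,x_{m;t}^{\pm1}]$. A cluster monomial is $\mathbf x_t^{\mathbf v}=\prod_{j=1}^mx_{j;t}^{v_j}$ with $\mathbf v\in\mathbb Z^m$ and $v_i\ge0$ for $i\in[1,n]$ ($v_j$ may be negative for frozen $j$). $\mathsf\Lambda$-structure. $(\widetilde B,\Lambda)$, $\Lambda$ an $m\times m$ skew-symmetric integer matrix, is a compatible pair of type $S=\mathrm{diag}(s_1,\dots,s_n)$ ($s_i\in\mathbb Z_{>0}$) if $\widetilde B^T\Lambda=(S\mid\mathbf 0)$, $\mathbf 0$ the $n\times(m-n)$ zero matrix. Its mutation in direction $k$ is $(\mu_k(\widetilde B),E^T\Lambda E)$, where $E$ is $I_m$ with $k$th column replaced by the column with entries $e_k=-1$, $e_i=[-\varepsilon b_{ik}]_+$ ($i\ne k$), for a sign $\varepsilon\in\{\pm1\}$ (the result does not depend on $\varepsilon$, and is again compatible of type $S$). $\mathcal U$ is a $\mathsf\Lambda$-upper cluster algebra of type $S$ if it is given with skew-symmetric matrices $\Lambda_t$, $t\in\mathbb T_n$, such that each $(\widetilde B_t,\Lambda_t)$ is a compatible pair (of type $S$) and pairs at the ends of an edge labelled $k$ are related by mutation in direction $k$. Then all $\widetilde B_t$ have rank $n$. Good elements. A tropical point is a family $\{\mathbf g^t\in\mathbb Z^m\mid t\in\mathbb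 T_n\}$ such that for every edge labelled $k$ between $t$ and $t'$: $g_k^{t'}=-g_k^t$ and $g_i^{t'}=g_i^t+[-b_{ik;t}]_+g_k^t+b_{ik;t}[g_k^t]_+$ for $i\ne k$. An element $u\in\mathcal U$ is pointed at $t$ if $u=\mathbf x_t^{\mathbf g_u^t}F_u^t(\hat y_{1;t},\dots,\hat y_{n;t})$ with $\mathbf g_u^t\in\mathbb Z^m$ and $F_u^t\in\mathbb Z[y_1,\dots,y_n]$ with constant term $1$ (these are then unique; this is the canonical expression, $\mathbf g_u^t$ the extended $g$-vector, $F_u^t$ the $F$-polynomial). $u$ is good if it is pointed at every $t$, $\{\mathbf g_u^t\}_t$ is a tropical point, and $u\in\mathbb Z_{\ge0}[x_{1;t}^{\pm1},\dots,x_{m;t}^{\pm1}]$ for all $t$. Every cluster monomial is good. Invariants. $\mathbb Z^{\max}=(\mathbb Z,+,\max)$ is the tropical semifield and $\mathbb F_{>0}=\mathbb Q_{\rm sf}(x_{1;t_0},\dots,x_{m;t_0})$ is the semifield of nonzero rational functions with subtraction-free expressions. For a good element $u$ there is a unique semifield homomorphism $\beta_u:\mathbb F_{>0}\to\mathbb Z^{\max}$ with $(\beta_u(x_{1;t}),\dots,\beta_u(x_{m;t}))=(\Lambda_t\mathbf g_u^t)^T$ for all $t\in\mathbb T_n$. For good $u,u'$: $\langle u,u'\rangle_{\rm trop}:=\beta_{u'}(u)$ (tropical invariant) and $(u\mid\mid u')_F:=\langle u,u'\rangle_{\rm trop}+\langle u',u\rangle_{\rm trop}$ ($F$-invariant).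 For a nonzero polynomial $F=\sum_{\mathbf v}c_{\mathbf v}\mathbf y^{\mathbf v}\in\mathbb Z[y_1,\dots,y_n]$ and $\mathbf r\in\mathbb Z^n$, $F[\mathbf r]:=\max\{\mathbf v^T\mathbf r\mid c_{\mathbf v}\ne0\}$. *)

theory Defs
  imports
    "Jordan_Normal_Form.Matrix"
    "HOL-Library.Poly_Mapping"
    "HOL-Library.FuncSet"
begin

text \<open>
  Vectors and matrices are those of Jordan Normal Form, so all indices start at \<open>0\<close>: a seed has
  cluster variables \<open>x $ 0, \<dots>, x $ (m - 1)\<close>, of which the first \<open>n\<close> are unfrozen, and mutation
  directions are the \<open>k < n\<close>.  The ambient field is a type \<open>'a :: field_char_0\<close>; a seed contains a
  free generating set of the whole type over the rationals, which makes \<open>'a\<close> a field of rational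
  functions over \<open>\<rat>\<close> in \<open>m\<close> variables.
\<close>

section \<open>Polynomials, Laurent polynomials and free generating sets\<close>

text \<open>A polynomial is a finitely supported map from exponents (finitely supported maps from
  variable indices to \<open>nat\<close>) to coefficients.\<close>

type_synonym 'b mpoly = "(nat \<Rightarrow>\<^sub>0 nat) \<Rightarrow>\<^sub>0 'b"

definition in_vars :: "nat \<Rightarrow> 'b::zero mpoly \<Rightarrow> bool" where
  "in_vars n P \<longleftrightarrow> (\<forall>v \<in> Poly_Mapping.keys P. Poly_Mapping.keys v \<subseteq> {..<n})"

definition peval :: "('b::zero \<Rightarrow> 'a) \<Rightarrow> 'a::comm_semiring_1 vec \<Rightarrow> 'b mpoly \<Rightarrow> 'a" where
  "peval h y P = (\<Sum>v \<in> Poly_Mapping.keys P. h (Poly_Mapping.lookup P v) *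
     (\<Prod>i \<in> Poly_Mapping.keys v. (y $ i) ^ Poly_Mapping.lookup v i))"

definition free_generating_set :: "'a::field_char_0 vec \<Rightarrow> bool" where
  "free_generating_set x \<longleftrightarrow>
     (\<forall>P :: rat mpoly. in_vars (dim_vec x) P \<and> peval of_rat x P = 0 \<longrightarrow> P = 0) \<and>
     (\<forall>f. \<exists>P Q :: rat mpoly. in_vars (dim_vec x) P \<and> in_vars (dim_vec x) Q \<and>
        peval of_rat x Q \<noteq> 0 \<and> f = peval of_rat x P / peval of_rat x Q)"

definition lmono :: "'a::field vec \<Rightarrow> int vec \<Rightarrow> 'a" where
  "lmono x v = (\<Prod>j < dim_vec x. (x $ j) powi (v $ j))"

definition laurent_ring :: "'a::field vec \<Rightarrow> 'a set" where
  "laurent_ring x =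
     {\<Sum>v \<in> V. of_int (c v) * lmono x v | V c. finite V \<and> V \<subseteq> carrier_vec (dim_vec x)}"

definition laurent_nonneg :: "'a::field vec \<Rightarrow> 'a set" where
  "laurent_nonneg x =
     {\<Sum>v \<in> V. of_int (c v) * lmono x v | V c.
        finite V \<and> V \<subseteq> carrier_vec (dim_vec x) \<and> (\<forall>v \<in> V. c v \<ge> 0)}"

text \<open>\<open>F[r]\<close>, meaningful for nonzero \<open>F\<close>.\<close>

definition poly_max :: "int mpoly \<Rightarrow> int vec \<Rightarrow> int" where
  "poly_max F r =
     Max ((\<lambda>v. \<Sum>i < dim_vec r. int (Poly_Mapping.lookup v i) * r $ i) ` Poly_Mapping.keys F)"


section \<open>Seeds and mutation\<close>

abbreviation pos_part :: "int \<Rightarrow> int" where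
  "pos_part a \<equiv> max a 0"

definition skew_symmetric :: "int mat \<Rightarrow> bool" where
  "skew_symmetric A \<longleftrightarrow> square_mat A \<and> transpose_mat A = - A"

definition pos_diagonal :: "nat \<Rightarrow> int mat \<Rightarrow> bool" where
  "pos_diagonal n S \<longleftrightarrow> S \<in> carrier_mat n n \<and> diagonal_mat S \<and> (\<forall>i < n. S $$ (i, i) > 0)"

definition mutation_matrix :: "nat \<Rightarrow> nat \<Rightarrow> int mat \<Rightarrow> bool" where
  "mutation_matrix m n B \<longleftrightarrow> B \<in> carrier_mat m n \<and>
     (\<exists>S. pos_diagonal n S \<and> skew_symmetric (S * mat n n (\<lambda>(i, j). B $$ (i, j))))"

definition mutate_matrix :: "nat \<Rightarrow> int mat \<Rightarrow> int mat" where
  "mutate_matrix k B = mat (dim_row B) (dim_col B) (\<lambda>(i, j).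
     if i = k \<or> j = k then - (B $$ (i, j))
     else B $$ (i, j) + pos_part (B $$ (i, k)) * pos_part (B $$ (k, j))
                      - pos_part (- (B $$ (i, k))) * pos_part (- (B $$ (k, j))))"

definition mutate_cluster :: "nat \<Rightarrow> int mat \<Rightarrow> 'a::field vec \<Rightarrow> 'a vec" where
  "mutate_cluster k B x = vec (dim_vec x) (\<lambda>i.
     if i = k then
       ((\<Prod>j < dim_vec x. (x $ j) powi pos_part (B $$ (j, k))) +
        (\<Prod>j < dim_vec x. (x $ j) powi pos_part (- (B $$ (j, k))))) / x $ k
     else x $ i)"

definition is_seed :: "nat \<Rightarrow> nat \<Rightarrow> 'a::field_char_0 vec \<Rightarrow> int mat \<Rightarrow> bool" where
  "is_seed m n x B \<longleftrightarrow>
     x \<in> carrier_vec m \<and> free_generating_set x \<and> mutation_matrix m n B"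

definition yhat :: "'a::field vec \<Rightarrow> int mat \<Rightarrow> 'a vec" where
  "yhat x B = vec (dim_col B) (\<lambda>k. lmono x (col B k))"


section \<open>The labelled regular tree and cluster patterns\<close>

text \<open>The \<open>n\<close>-regular tree is modelled by the reduced words in the labels \<open>0, \<dots>, n - 1\<close>, a word being
  reduced if no two adjacent letters coincide.  The word is the label sequence of the path from the
  vertex to the root \<open>[]\<close>.\<close>

definition tree_vertices :: "nat \<Rightarrow> nat list set" where
  "tree_vertices n = {t. set t \<subseteq> {..<n} \<and> distinct_adj t}"

definition tree_edge :: "nat \<Rightarrow> nat \<Rightarrow> nat list \<Rightarrow> nat list \<Rightarrow> bool" where
  "tree_edge n k t t' \<longleftrightarrow>
     t \<in> tree_vertices n \<and> t' \<in> tree_vertices n \<and> (t' = k # t \<or> t = k # t')"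

lemma tree_edge_sym: "tree_edge n k t t' \<longleftrightarrow> tree_edge n k t' t"
  by (auto simp: tree_edge_def)

lemma tree_regular:
  assumes "t \<in> tree_vertices n" "k < n"
  shows "\<exists>!t'. tree_edge n k t t'"
proof (cases t)
  case Nil
  then show ?thesis using assms by (auto simp: tree_edge_def tree_vertices_def)
next
  case (Cons a s)
  then have s: "s \<in> tree_vertices n"
    using assms by (cases s) (auto simp: tree_vertices_def)
  show ?thesis
  proof (cases "a = k")
    case True
    then show ?thesis using assms Cons s
      by (intro ex1I[of _ s]) (auto simp: tree_edge_def tree_vertices_def)
  next
    case False
    then show ?thesis using assms Cons
      by (intro ex1I[of _ "k # t"]) (auto simp: tree_edge_def tree_vertices_def)
  qed
qed

definition cluster_pattern ::
    "nat \<Rightarrow> nat \<Rightarrow> (nat list \<Rightarrow> 'a::field_char_0 vec) \<Rightarrow> (nat list \<Rightarrow> int mat) \<Rightarrow> bool" where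
  "cluster_pattern m n X B \<longleftrightarrow>
     (\<forall>t \<in> tree_vertices n. is_seed m n (X t) (B t)) \<and>
     (\<forall>k t t'. tree_edge n k t t' \<longrightarrow>
        X t' = mutate_cluster k (B t) (X t) \<and> B t' = mutate_matrix k (B t))"

definition upper_cluster_algebra :: "nat \<Rightarrow> (nat list \<Rightarrow> 'a::field_char_0 vec) \<Rightarrow> 'a set" where
  "upper_cluster_algebra n X = (\<Inter>t \<in> tree_vertices n. laurent_ring (X t))"

definition cluster_monomial :: "nat \<Rightarrow> nat \<Rightarrow> (nat list \<Rightarrow> 'a::field_char_0 vec) \<Rightarrow> 'a \<Rightarrow> bool" where
  "cluster_monomial m n X u \<longleftrightarrow>
     (\<exists>t \<in> tree_vertices n. \<exists>v \<in> carrier_vec m. (\<forall>i < n. v $ i \<ge> 0) \<and> u = lmono (X t) v)"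


section \<open>Compatible pairs and Lambda-structures\<close>

text \<open>The \<open>n \<times> m\<close> matrix \<open>(S | 0)\<close>.\<close>

definition pad_zero :: "nat \<Rightarrow> int mat \<Rightarrow> int mat" where
  "pad_zero m S = mat (dim_row S) m (\<lambda>(i, j). if j < dim_col S then S $$ (i, j) else 0)"

definition compatible_pair :: "nat \<Rightarrow> nat \<Rightarrow> int mat \<Rightarrow> int mat \<Rightarrow> int mat \<Rightarrow> bool" where
  "compatible_pair m n S B \<Lambda> \<longleftrightarrow>
     pos_diagonal n S \<and> mutation_matrix m n B \<and> \<Lambda> \<in> carrier_mat m m \<and> skew_symmetric \<Lambda> \<and>
     transpose_mat B * \<Lambda> = pad_zero m S"

definition mutation_E :: "int \<Rightarrow> nat \<Rightarrow> int mat \<Rightarrow> int mat" where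
  "mutation_E \<epsilon> k B = mat (dim_row B) (dim_row B) (\<lambda>(i, j).
     if j = k then (if i = k then - 1 else pos_part (- \<epsilon> * B $$ (i, k)))
     else (if i = j then 1 else 0))"

text \<open>For compatible pairs the two signs give the same matrix, so it does not matter which one is
  used.\<close>

definition Lambda_mutation :: "nat \<Rightarrow> int mat \<Rightarrow> int mat \<Rightarrow> int mat \<Rightarrow> bool" where
  "Lambda_mutation k B \<Lambda> \<Lambda>' \<longleftrightarrow>
     (\<exists>\<epsilon> \<in> {1, -1}. \<Lambda>' = transpose_mat (mutation_E \<epsilon> k B) * \<Lambda> * mutation_E \<epsilon> k B)"

definition Lambda_structure ::
    "nat \<Rightarrow> nat \<Rightarrow> int mat \<Rightarrow> (nat list \<Rightarrow> int mat) \<Rightarrow> (nat list \<Rightarrow> int mat) \<Rightarrow> bool" where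
  "Lambda_structure m n S B \<Lambda> \<longleftrightarrow>
     (\<forall>t \<in> tree_vertices n. compatible_pair m n S (B t) (\<Lambda> t)) \<and>
     (\<forall>k t t'. tree_edge n k t t' \<longrightarrow> Lambda_mutation k (B t) (\<Lambda> t) (\<Lambda> t'))"


section \<open>Good elements\<close>

definition tropical_point ::
    "nat \<Rightarrow> nat \<Rightarrow> (nat list \<Rightarrow> int mat) \<Rightarrow> (nat list \<Rightarrow> int vec) \<Rightarrow> bool" where
  "tropical_point m n B g \<longleftrightarrow>
     (\<forall>t \<in> tree_vertices n. g t \<in> carrier_vec m) \<and>
     (\<forall>k t t'. tree_edge n k t t' \<longrightarrow>
        g t' $ k = - (g t $ k) \<and>
        (\<forall>i < m. i \<noteq> k \<longrightarrow>
           g t' $ i = g t $ i + pos_part (- (B t $$ (i, k))) * g t $ k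
                              + B t $$ (i, k) * pos_part (g t $ k)))"

definition canonical_expr ::
    "'a::field_char_0 vec \<Rightarrow> int mat \<Rightarrow> 'a \<Rightarrow> int vec \<Rightarrow> int mpoly \<Rightarrow> bool" where
  "canonical_expr x B u g F \<longleftrightarrow>
     g \<in> carrier_vec (dim_vec x) \<and> in_vars (dim_col B) F \<and> Poly_Mapping.lookup F 0 = 1 \<and>
     u = lmono x g * peval of_int (yhat x B) F"

definition pointed :: "'a::field_char_0 vec \<Rightarrow> int mat \<Rightarrow> 'a \<Rightarrow> bool" where
  "pointed x B u \<longleftrightarrow> (\<exists>g F. canonical_expr x B u g F)"

text \<open>The extended g-vector of a pointed element; it is unique when \<open>B\<close> has full column rank.\<close>

definition g_vector :: "'a::field_char_0 vec \<Rightarrow> int mat \<Rightarrow> 'a \<Rightarrow> int vec" where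
  "g_vector x B u = (THE g. \<exists>F. canonical_expr x B u g F)"

definition good ::
    "nat \<Rightarrow> nat \<Rightarrow> (nat list \<Rightarrow> 'a::field_char_0 vec) \<Rightarrow> (nat list \<Rightarrow> int mat) \<Rightarrow> 'a \<Rightarrow> bool" where
  "good m n X B u \<longleftrightarrow>
     u \<in> upper_cluster_algebra n X \<and>
     (\<forall>t \<in> tree_vertices n. pointed (X t) (B t) u) \<and>
     tropical_point m n B (\<lambda>t. g_vector (X t) (B t) u) \<and>
     (\<forall>t \<in> tree_vertices n. u \<in> laurent_nonneg (X t))"


section \<open>Tropical invariant and F-invariant\<close>

text \<open>The elements with a subtraction-free expression in \<open>x\<close>.  When \<open>x\<close> is algebraically independent
  over \<open>\<rat>\<close> none of them is zero, so the division rule needs no side condition.\<close>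

inductive_set subtraction_free :: "'a::field_char_0 vec \<Rightarrow> 'a set" for x where
  rat: "0 < q \<Longrightarrow> of_rat q \<in> subtraction_free x"
| var: "i < dim_vec x \<Longrightarrow> x $ i \<in> subtraction_free x"
| add: "a \<in> subtraction_free x \<Longrightarrow> b \<in> subtraction_free x \<Longrightarrow> a + b \<in> subtraction_free x"
| mult: "a \<in> subtraction_free x \<Longrightarrow> b \<in> subtraction_free x \<Longrightarrow> a * b \<in> subtraction_free x"
| div: "a \<in> subtraction_free x \<Longrightarrow> b \<in> subtraction_free x \<Longrightarrow> a / b \<in> subtraction_free x"

text \<open>Homomorphisms into \<open>(\<int>, +, max)\<close>, whose multiplication is \<open>+\<close> and whose addition is \<open>max\<close>.\<close>

definition max_semifield_hom :: "'a::field_char_0 set \<Rightarrow> ('a \<Rightarrow> int) \<Rightarrow> bool" where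
  "max_semifield_hom D \<beta> \<longleftrightarrow>
     (\<forall>a \<in> D. \<forall>b \<in> D. \<beta> (a * b) = \<beta> a + \<beta> b \<and> \<beta> (a + b) = max (\<beta> a) (\<beta> b))"

text \<open>\<open>\<beta>\<^sub>u\<close>.  Functions are total in HOL; the homomorphism on \<open>subtraction_free (X [])\<close> is made unique
  as a total function by requiring it to be \<open>undefined\<close> elsewhere.\<close>

definition beta ::
    "nat \<Rightarrow> (nat list \<Rightarrow> 'a::field_char_0 vec) \<Rightarrow> (nat list \<Rightarrow> int mat) \<Rightarrow> (nat list \<Rightarrow> int mat)
      \<Rightarrow> 'a \<Rightarrow> 'a \<Rightarrow> int" where
  "beta n X B \<Lambda> u = (THE \<beta>.
     \<beta> \<in> extensional (subtraction_free (X [])) \<and>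
     max_semifield_hom (subtraction_free (X [])) \<beta> \<and>
     (\<forall>t \<in> tree_vertices n. map_vec \<beta> (X t) = \<Lambda> t *\<^sub>v g_vector (X t) (B t) u))"

definition trop_invariant ::
    "nat \<Rightarrow> (nat list \<Rightarrow> 'a::field_char_0 vec) \<Rightarrow> (nat list \<Rightarrow> int mat) \<Rightarrow> (nat list \<Rightarrow> int mat)
      \<Rightarrow> 'a \<Rightarrow> 'a \<Rightarrow> int" where
  "trop_invariant n X B \<Lambda> u u' = beta n X B \<Lambda> u' u"

definition F_invariant ::
    "nat \<Rightarrow> (nat list \<Rightarrow> 'a::field_char_0 vec) \<Rightarrow> (nat list \<Rightarrow> int mat) \<Rightarrow> (nat list \<Rightarrow> int mat)
      \<Rightarrow> 'a \<Rightarrow> 'a \<Rightarrow> int" where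
  "F_invariant n X B \<Lambda> u u' = trop_invariant n X B \<Lambda> u u' + trop_invariant n X B \<Lambda> u' u"

end

theory Submission
  imports Defs
begin

text \<open>
  A semifield homomorphism into \<open>(\<int>, +, max)\<close> takes a Laurent polynomial with positive coefficients
  to the maximum of a linear functional over its support.  For a good element \<open>u = x\<^sup>g F(y)\<close>, with
  \<open>y\<close> the \<open>yhat\<close> vector, the support consists of the exponents \<open>g + B v\<close> with \<open>v\<close> an exponent of \<open>F\<close>;
  these are distinct, since
  \<open>B\<^sup>T \<Lambda> = (S | 0)\<close> makes \<open>B\<close> injective, and \<open>(B v)\<^sup>T \<Lambda> g' = v\<^sup>T (S | 0) g'\<close>.  This gives (i).  Adding the
  two instances of (i) gives (ii), as \<open>\<Lambda>\<close> is skew-symmetric.  For (iii), the right-hand side of (ii) may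
  be computed at a vertex where \<open>u\<close> is a monomial, so that \<open>F = 1\<close>.  That the homomorphism \<open>\<beta>\<close> exists
  means that the vectors \<open>\<Lambda>\<^sub>t g\<^sub>t\<close> of a tropical point mutate by the tropical exchange relation.
\<close>

section \<open>Laurent monomials in a free generating set\<close>

lemma peval_single:
  "c \<noteq> 0 \<Longrightarrow> peval h x (Poly_Mapping.single v c) =
    h c * (\<Prod>i \<in> Poly_Mapping.keys v. (x $ i) ^ Poly_Mapping.lookup v i)"
  by (simp add: peval_def)

lemma free_generating_set_nonzero:
  fixes x :: "'a::field_char_0 vec"
  assumes "free_generating_set x" "i < dim_vec x"
  shows "x $ i \<noteq> 0"
proof
  assume "x $ i = 0"
  let ?P = "Poly_Mapping.single (Poly_Mapping.single i 1) 1 :: rat mpoly"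
  have "in_vars (dim_vec x) ?P" using assms(2) by (simp add: in_vars_def)
  moreover have "peval of_rat x ?P = 0" using \<open>x $ i = 0\<close> by (simp add: peval_single)
  ultimately have "?P = 0" using assms(1) unfolding free_generating_set_def by blast
  thus False by (metis lookup_single_eq lookup_zero one_neq_zero)
qed

lemma lmono_add:
  assumes "\<And>i. i < dim_vec x \<Longrightarrow> x $ i \<noteq> 0" "v \<in> carrier_vec (dim_vec x)" "w \<in> carrier_vec (dim_vec x)"
  shows "lmono x (v + w) = lmono x v * lmono x w"
  unfolding lmono_def prod.distrib[symmetric] using assms
  by (intro prod.cong) (auto simp: power_int_add)

lemma lmono_zero: "lmono x (0\<^sub>v (dim_vec x)) = 1"
  by (simp add: lmono_def)

lemma lmono_unit_vec: "i < dim_vec x \<Longrightarrow> lmono x (unit_vec (dim_vec x) i) = x $ i"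
proof -
  assume i: "i < dim_vec x"
  have "lmono x (unit_vec (dim_vec x) i) = (\<Prod>j<dim_vec x. if j = i then x $ i else 1)"
    unfolding lmono_def using i by (intro prod.cong) auto
  also have "\<dots> = x $ i" using i by (simp add: prod.delta)
  finally show ?thesis .
qed

text \<open>Multiplying by a monomial with large exponents turns a Laurent relation into a polynomial one.\<close>

lemma lmono_independent:
  fixes x :: "'a::field_char_0 vec" and c :: "int vec \<Rightarrow> rat"
  assumes free: "free_generating_set x"
    and V: "finite V" "V \<subseteq> carrier_vec (dim_vec x)"
    and sum0: "(\<Sum>v\<in>V. of_rat (c v) * lmono x v) = 0"
    and "v \<in> V"
  shows "c v = 0"
proof (rule ccontr)
  assume cv: "c v \<noteq> 0"
  define m where "m = dim_vec x"
  \<comment> \<open>Without the zero coefficients, the keys of \<open>P\<close> below are exactly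
    the image of \<open>W\<close> under \<open>enc\<close>.\<close>
  define W where "W = {v \<in> V. c v \<noteq> 0}"
  have W: "finite W" "W \<subseteq> carrier_vec m" "v \<in> W"
    using V \<open>v \<in> V\<close> cv by (auto simp: W_def m_def)
  have nz: "\<And>i. i < m \<Longrightarrow> x $ i \<noteq> 0" using free_generating_set_nonzero[OF free] m_def by auto
  \<comment> \<open>One crude shift for all exponents: the sum of all absolute values bounds every
    entry below by \<open>- N\<close>.\<close>
  define N where "N = (\<Sum>v\<in>W. \<Sum>i<m. \<bar>v $ i\<bar>)"
  have N: "0 \<le> v $ i + N" if "v \<in> W" "i < m" for v i
  proof -
    have "\<bar>v $ i\<bar> \<le> (\<Sum>i<m. \<bar>v $ i\<bar>)"
      using that by (intro member_le_sum) auto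
    also have "\<dots> \<le> N" unfolding N_def
      using that W(1) by (intro member_le_sum[of v W "\<lambda>v. \<Sum>i<m. \<bar>v $ i\<bar>"]) (auto intro: sum_nonneg)
    finally show ?thesis by linarith
  qed
  define enc :: "int vec \<Rightarrow> nat \<Rightarrow>\<^sub>0 nat" where
    "enc v = Abs_poly_mapping (\<lambda>i. if i < m then nat (v $ i + N) else 0)" for v
  have lk: "Poly_Mapping.lookup (enc v) = (\<lambda>i. if i < m then nat (v $ i + N) else 0)" for v
    unfolding enc_def
    by (rule Abs_poly_mapping_inverse) (auto intro: finite_subset[of _ "{..<m}"] split: if_splits)
  have keys_enc: "Poly_Mapping.keys (enc v) \<subseteq> {..<m}" for v
    by (auto simp: in_keys_iff lk split: if_splits)
  have inj: "inj_on enc W"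
  proof (rule inj_onI)
    fix a b assume ab: "a \<in> W" "b \<in> W" "enc a = enc b"
    show "a = b"
    proof (rule eq_vecI)
      show "dim_vec a = dim_vec b" using ab W by (metis carrier_vecD subsetD)
      fix i assume "i < dim_vec b"
      hence i: "i < m" using ab W by (metis carrier_vecD subsetD)
      have "nat (a $ i + N) = nat (b $ i + N)" using ab(3) lk[of a] lk[of b] i by metis
      thus "a $ i = b $ i" using N[OF ab(1) i] N[OF ab(2) i] by auto
    qed
  qed
  \<comment> \<open>The Laurent relation multiplied by the monomial with all exponents
    \<open>N\<close>: the coefficients \<open>c\<close> are carried along the injection
    \<open>enc\<close>.\<close>
  define P :: "rat mpoly" where
    "P = Abs_poly_mapping (\<lambda>e. if e \<in> enc ` W then c (the_inv_into W enc e) else 0)"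
  have lkP: "Poly_Mapping.lookup P = (\<lambda>e. if e \<in> enc ` W then c (the_inv_into W enc e) else 0)"
    unfolding P_def
    by (rule Abs_poly_mapping_inverse) (auto intro: finite_subset[of _ "enc ` W"] W split: if_splits)
  have lkPe: "Poly_Mapping.lookup P (enc v) = c v" if "v \<in> W" for v
    using that by (simp add: lkP the_inv_into_f_f[OF inj])
  have keysP: "Poly_Mapping.keys P = enc ` W"
    using lkPe by (auto simp: in_keys_iff W_def lkP split: if_splits)
  have "peval of_rat x P = (\<Sum>v\<in>W. of_rat (c v) *
      (\<Prod>i \<in> Poly_Mapping.keys (enc v). (x $ i) ^ Poly_Mapping.lookup (enc v) i))"
    unfolding peval_def keysP sum.reindex[OF inj] by (intro sum.cong) (auto simp: lkPe)
  also have "\<dots> = (\<Sum>v\<in>W. of_rat (c v) * (lmono x v * lmono x (vec m (\<lambda>_. N))))"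
  proof (intro sum.cong refl arg_cong2[where f="(*)"])
    fix v assume v: "v \<in> W"
    have "(\<Prod>i \<in> Poly_Mapping.keys (enc v). (x $ i) ^ Poly_Mapping.lookup (enc v) i)
       = (\<Prod>i<m. (x $ i) ^ Poly_Mapping.lookup (enc v) i)"
      by (rule prod.mono_neutral_left) (use keys_enc in \<open>auto simp: in_keys_iff\<close>)
    also have "\<dots> = (\<Prod>i<m. x $ i powi (v + vec m (\<lambda>_. N)) $ i)"
      using N[OF v] by (intro prod.cong) (auto simp: lk power_int_def)
    also have "\<dots> = lmono x v * lmono x (vec m (\<lambda>_. N))"
      using lmono_add[of x v "vec m (\<lambda>_. N)"] nz v W by (auto simp: lmono_def m_def)
    finally show "(\<Prod>i \<in> Poly_Mapping.keys (enc v). (x $ i) ^ Poly_Mapping.lookup (enc v) i)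
       = lmono x v * lmono x (vec m (\<lambda>_. N))" .
  qed
  also have "\<dots> = (\<Sum>v\<in>W. of_rat (c v) * lmono x v) * lmono x (vec m (\<lambda>_. N))"
    by (simp add: sum_distrib_right mult.assoc)
  also have "(\<Sum>v\<in>W. of_rat (c v) * lmono x v) = (\<Sum>v\<in>V. of_rat (c v) * lmono x v)"
    by (rule sum.mono_neutral_left) (auto simp: W_def V)
  finally have "peval of_rat x P = 0" using sum0 by simp
  moreover have "in_vars (dim_vec x) P"
    using keys_enc by (auto simp: in_vars_def keysP m_def)
  ultimately have "P = 0" using free unfolding free_generating_set_def by blast
  with keysP W show False by auto
qed

section \<open>Supports of Laurent polynomials\<close>

definition laurent_support :: "'a::field_char_0 vec \<Rightarrow> 'a \<Rightarrow> int vec set \<Rightarrow> bool" where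
  "laurent_support x f V \<longleftrightarrow> finite V \<and> V \<subseteq> carrier_vec (dim_vec x) \<and>
     (\<exists>c :: int vec \<Rightarrow> rat. (\<forall>v\<in>V. c v \<noteq> 0) \<and> f = (\<Sum>v\<in>V. of_rat (c v) * lmono x v))"

text \<open>Nonemptiness excludes zero, for which a maximum over the support would make no sense.
  Positivity rules out cancellation in sums and products.\<close>

definition pos_laurent_support :: "'a::field_char_0 vec \<Rightarrow> 'a \<Rightarrow> int vec set \<Rightarrow> bool" where
  "pos_laurent_support x f V \<longleftrightarrow> finite V \<and> V \<noteq> {} \<and> V \<subseteq> carrier_vec (dim_vec x) \<and>
     (\<exists>c :: int vec \<Rightarrow> rat. (\<forall>v\<in>V. c v > 0) \<and> f = (\<Sum>v\<in>V. of_rat (c v) * lmono x v))"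

lemma pos_laurent_support_imp: "pos_laurent_support x f V \<Longrightarrow> laurent_support x f V"
  unfolding pos_laurent_support_def laurent_support_def by (metis less_irrefl)

text \<open>Extended by zero to \<open>V \<union> W\<close>, the two coefficient functions differ by
  a relation among distinct Laurent monomials, so they agree. The support is thus determined by the
  element, which later makes tropical values well defined.\<close>

lemma laurent_support_unique:
  assumes free: "free_generating_set x"
    and f: "laurent_support x f V" "laurent_support x f W"
  shows "V = W"
proof -
  from f obtain c d where
    c: "finite V" "V \<subseteq> carrier_vec (dim_vec x)" "\<forall>v\<in>V. c v \<noteq> 0" "f = (\<Sum>v\<in>V. of_rat (c v) * lmono x v)" and
    d: "finite W" "W \<subseteq> carrier_vec (dim_vec x)" "\<forall>v\<in>W. d v \<noteq> 0" "f = (\<Sum>v\<in>W. of_rat (d v) * lmono x v)"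
    unfolding laurent_support_def by blast
  define c' where "c' v = (if v \<in> V then c v else 0)" for v
  define d' where "d' v = (if v \<in> W then d v else 0)" for v
  have "f = (\<Sum>v\<in>V\<union>W. of_rat (c' v) * lmono x v)" unfolding c(4)
    by (intro sum.mono_neutral_cong_left) (auto simp: c'_def c d)
  moreover have "f = (\<Sum>v\<in>V\<union>W. of_rat (d' v) * lmono x v)" unfolding d(4)
    by (intro sum.mono_neutral_cong_left) (auto simp: d'_def c d)
  ultimately have "(\<Sum>v\<in>V\<union>W. of_rat (c' v) * lmono x v) - (\<Sum>v\<in>V\<union>W. of_rat (d' v) * lmono x v) = 0"
    by (metis diff_self)
  hence "(\<Sum>v\<in>V\<union>W. of_rat (c' v - d' v) * lmono x v) = 0"
    by (simp add: sum_subtractf of_rat_diff left_diff_distrib)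
  hence "c' v = d' v" if "v \<in> V \<union> W" for v
    using lmono_independent[OF free _ _ _ that, where c="\<lambda>v. c' v - d' v"] c d by auto
  thus ?thesis using c(3) d(3) unfolding c'_def d'_def by (metis UnCI subset_antisym subsetI)
qed

lemma pos_laurent_support_nonzero:
  assumes "free_generating_set x" "pos_laurent_support x f V"
  shows "f \<noteq> 0"
proof
  assume "f = 0"
  hence "laurent_support x f {}" by (simp add: laurent_support_def)
  with assms laurent_support_unique pos_laurent_support_imp have "V = {}" by metis
  with assms(2) show False by (simp add: pos_laurent_support_def)
qed

lemma pos_laurent_support_const:
  "0 < q \<Longrightarrow> pos_laurent_support x (of_rat q) {0\<^sub>v (dim_vec x)}"
  unfolding pos_laurent_support_def
  by (auto simp: lmono_zero intro!: exI[of _ "\<lambda>_. q"])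

lemma pos_laurent_support_var:
  "i < dim_vec x \<Longrightarrow> pos_laurent_support x (x $ i) {unit_vec (dim_vec x) i}"
  unfolding pos_laurent_support_def
  by (auto simp: lmono_unit_vec intro!: exI[of _ "\<lambda>_. 1"])

lemma pos_laurent_support_add:
  assumes "pos_laurent_support x f V" "pos_laurent_support x g W"
  shows "pos_laurent_support x (f + g) (V \<union> W)"
proof -
  from assms obtain c d where
    c: "finite V" "V \<noteq> {}" "V \<subseteq> carrier_vec (dim_vec x)" "\<forall>v\<in>V. c v > 0" "f = (\<Sum>v\<in>V. of_rat (c v) * lmono x v)" and
    d: "finite W" "W \<subseteq> carrier_vec (dim_vec x)" "\<forall>v\<in>W. d v > 0" "g = (\<Sum>v\<in>W. of_rat (d v) * lmono x v)"
    unfolding pos_laurent_support_def by blast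
  define c' where "c' v = (if v \<in> V then c v else 0)" for v
  define d' where "d' v = (if v \<in> W then d v else 0)" for v
  have "f = (\<Sum>v\<in>V\<union>W. of_rat (c' v) * lmono x v)" unfolding c(5)
    by (intro sum.mono_neutral_cong_left) (auto simp: c'_def c d)
  moreover have "g = (\<Sum>v\<in>V\<union>W. of_rat (d' v) * lmono x v)" unfolding d(4)
    by (intro sum.mono_neutral_cong_left) (auto simp: d'_def c d)
  ultimately have "f + g = (\<Sum>v\<in>V\<union>W. of_rat (c' v + d' v) * lmono x v)"
    by (simp add: sum.distrib of_rat_add distrib_right)
  moreover have "\<forall>v\<in>V\<union>W. c' v + d' v > 0"
    using c(4) d(3) by (auto simp: c'_def d'_def intro: add_pos_pos)
  ultimately show ?thesis unfolding pos_laurent_support_def using c d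
    by (intro conjI exI[of _ "\<lambda>v. c' v + d' v"]) auto
qed

text \<open>Several pairs may have the same sum, but their contributions are all positive, so no
  exponent of the sumset is lost.\<close>

lemma pos_laurent_support_mult:
  assumes free: "free_generating_set x"
    and "pos_laurent_support x f V" "pos_laurent_support x g W"
  shows "pos_laurent_support x (f * g) ((\<lambda>(v, w). v + w) ` (V \<times> W))"
proof -
  from assms obtain c d where
    c: "finite V" "V \<noteq> {}" "V \<subseteq> carrier_vec (dim_vec x)" "\<forall>v\<in>V. c v > 0" "f = (\<Sum>v\<in>V. of_rat (c v) * lmono x v)" and
    d: "finite W" "W \<noteq> {}" "W \<subseteq> carrier_vec (dim_vec x)" "\<forall>v\<in>W. d v > 0" "g = (\<Sum>v\<in>W. of_rat (d v) * lmono x v)"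
    unfolding pos_laurent_support_def by blast
  let ?p = "\<lambda>(v, w). v + w :: int vec"
  define e where "e z = (\<Sum>p\<in>{p \<in> V \<times> W. ?p p = z}. c (fst p) * d (snd p))" for z
  have fin: "finite (V \<times> W)" using c d by simp
  have "f * g = (\<Sum>p\<in>V\<times>W. of_rat (c (fst p) * d (snd p)) * lmono x (?p p))"
    unfolding c(5) d(5) sum_product sum.cartesian_product
    using c(3) d(3) free_generating_set_nonzero[OF free]
    by (intro sum.cong refl) (auto simp: of_rat_mult subset_iff lmono_add)
  also have "\<dots> = (\<Sum>z\<in>?p ` (V\<times>W). \<Sum>p\<in>{p \<in> V\<times>W. ?p p = z}. of_rat (c (fst p) * d (snd p)) * lmono x (?p p))"
    by (rule sum.image_gen[OF fin])
  also have "\<dots> = (\<Sum>z\<in>?p ` (V\<times>W). of_rat (e z) * lmono x z)"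
    unfolding e_def of_rat_sum sum_distrib_right by (intro sum.cong refl) auto
  finally have fg: "f * g = (\<Sum>z\<in>?p ` (V\<times>W). of_rat (e z) * lmono x z)" .
  have "e z > 0" if "z \<in> ?p ` (V \<times> W)" for z
    unfolding e_def using that fin c(4) d(4)
    by (intro sum_pos) (auto intro: finite_subset[OF _ fin])
  with fg show ?thesis unfolding pos_laurent_support_def using c(1-3) d(1-3) fin
    by (intro conjI exI[of _ e]) (auto, metis add_carrier_vec subsetD)
qed

section \<open>Homomorphisms to the max-plus semifield\<close>

text \<open>The support function of the Newton polytope spanned by \<open>V\<close>, in direction
  \<open>r\<close>: the tropical value of a positive Laurent polynomial whose variables take the
  values \<open>r\<close>.\<close>

definition trop_value :: "int vec \<Rightarrow> int vec set \<Rightarrow> int" where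
  "trop_value r V = Max ((\<lambda>v. v \<bullet> r) ` V)"

lemma trop_value_Un:
  assumes "finite V" "V \<noteq> {}" "finite W" "W \<noteq> {}"
  shows "trop_value r (V \<union> W) = max (trop_value r V) (trop_value r W)"
  unfolding trop_value_def image_Un using assms by (intro Max_Un) auto

text \<open>Maximizers in \<open>V\<close> and in \<open>W\<close> can be chosen independently. This
  is what turns products into sums.\<close>

lemma trop_value_sumset:
  assumes "finite V" "V \<noteq> {}" "finite W" "W \<noteq> {}" "r \<in> carrier_vec m"
    "V \<subseteq> carrier_vec m" "W \<subseteq> carrier_vec m"
  shows "trop_value r ((\<lambda>(v, w). v + w) ` (V \<times> W)) = trop_value r V + trop_value r W"
proof -
  have "Max ((\<lambda>v. v \<bullet> r) ` V) \<in> (\<lambda>v. v \<bullet> r) ` V" "Max ((\<lambda>v. v \<bullet> r) ` W) \<in> (\<lambda>v. v \<bullet> r) ` W"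
    using assms by (auto intro!: Max_in simp del: Max_in)
  then obtain v w where v: "v \<in> V" "trop_value r V = v \<bullet> r" and w: "w \<in> W" "trop_value r W = w \<bullet> r"
    unfolding trop_value_def by auto
  have dist: "(a + b) \<bullet> r = a \<bullet> r + b \<bullet> r" if "a \<in> V" "b \<in> W" for a b
    using that assms by (intro add_scalar_prod_distrib) auto
  show ?thesis unfolding trop_value_def[of _ "_ ` _"]
  proof (rule Max_eqI)
    show "finite ((\<lambda>v. v \<bullet> r) ` (\<lambda>(v, w). v + w) ` (V \<times> W))" using assms by auto
    have "trop_value r V + trop_value r W = (v + w) \<bullet> r" using dist v w by simp
    thus "trop_value r V + trop_value r W \<in> (\<lambda>v. v \<bullet> r) ` (\<lambda>(v, w). v + w) ` (V \<times> W)"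
      using v w by (auto intro!: image_eqI[of _ _ "(v, w)"])
    fix y assume "y \<in> (\<lambda>v. v \<bullet> r) ` (\<lambda>(v, w). v + w) ` (V \<times> W)"
    then obtain a b where ab: "a \<in> V" "b \<in> W" "y = (a + b) \<bullet> r" by auto
    have "a \<bullet> r \<le> trop_value r V" "b \<bullet> r \<le> trop_value r W"
      unfolding trop_value_def using ab assms by auto
    thus "y \<le> trop_value r V + trop_value r W" using ab dist by simp
  qed
qed

text \<open>Positive Laurent polynomials are in general not closed under division, but their
  quotients are closed under all the operations involved. This normal form shows that
  subtraction-free elements are nonzero and serves to define homomorphisms on them.\<close>

lemma subtraction_free_fraction:
  assumes free: "free_generating_set x" and "f \<in> subtraction_free x"
  shows "\<exists>a b V W. pos_laurent_support x a V \<and> pos_laurent_support x b W \<and> f = a / b"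
  using assms(2)
proof induction
  case (rat q)
  show ?case
    using pos_laurent_support_const[OF rat, of x] pos_laurent_support_const[of 1 x] by force
next
  case (var i)
  show ?case
    using pos_laurent_support_var[OF var] pos_laurent_support_const[of 1 x] by force
next
  case (add f g)
  then obtain a b V W a' b' V' W' where
    *: "pos_laurent_support x a V" "pos_laurent_support x b W" "f = a / b"
       "pos_laurent_support x a' V'" "pos_laurent_support x b' W'" "g = a' / b'" by metis
  have "f + g = (a * b' + a' * b) / (b * b')"
    using *(3,6) pos_laurent_support_nonzero[OF free] *(2,5) by (metis add_frac_eq)
  thus ?case using * pos_laurent_support_mult[OF free] pos_laurent_support_add by metis
next
  case (mult f g)
  then obtain a b V W a' b' V' W' where
    *: "pos_laurent_support x a V" "pos_laurent_support x b W" "f = a / b"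
       "pos_laurent_support x a' V'" "pos_laurent_support x b' W'" "g = a' / b'" by metis
  have "f * g = (a * a') / (b * b')" using * by simp
  thus ?case using * pos_laurent_support_mult[OF free] by metis
next
  case (div f g)
  then obtain a b V W a' b' V' W' where
    *: "pos_laurent_support x a V" "pos_laurent_support x b W" "f = a / b"
       "pos_laurent_support x a' V'" "pos_laurent_support x b' W'" "g = a' / b'" by metis
  have "f / g = (a * b') / (b * a')" using * by simp
  thus ?case using * pos_laurent_support_mult[OF free] by metis
qed

lemma subtraction_free_nonzero:
  assumes "free_generating_set x" "f \<in> subtraction_free x"
  shows "f \<noteq> 0"
  using subtraction_free_fraction[OF assms] pos_laurent_support_nonzero[OF assms(1)] by force

text \<open>Universal property of the semifield: free generators may take arbitrary integer values.
  The value of a fraction is the difference of two support functions.\<close>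

lemma max_semifield_hom_exists:
  fixes x :: "'a::field_char_0 vec"
  assumes free: "free_generating_set x" and r: "r \<in> carrier_vec (dim_vec x)"
  obtains \<beta> where "max_semifield_hom (subtraction_free x) \<beta>" "\<And>i. i < dim_vec x \<Longrightarrow> \<beta> (x $ i) = r $ i"
proof -
  \<comment> \<open>A relation at first, because an element is a fraction in many ways;
    \<open>uniq\<close> shows that it is single-valued.\<close>
  define R where "R f t \<longleftrightarrow> (\<exists>a b V W. pos_laurent_support x a V \<and> pos_laurent_support x b W \<and> f = a / b \<and>
     t = trop_value r V - trop_value r W)" for f t
  have trop_mult: "trop_value r ((\<lambda>(v, w). v + w) ` (V \<times> W)) = trop_value r V + trop_value r W"
    if "pos_laurent_support x a V" "pos_laurent_support x b W" for a b V W
    using that r by (intro trop_value_sumset[of _ _ _ "dim_vec x"]) (auto simp: pos_laurent_support_def)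
  have trop_add: "trop_value r (V \<union> W) = max (trop_value r V) (trop_value r W)"
    if "pos_laurent_support x a V" "pos_laurent_support x b W" for a b V W
    using that by (intro trop_value_Un) (auto simp: pos_laurent_support_def)
  note mult = pos_laurent_support_mult[OF free]
  have uniq: "s = t" if "R f s" "R f t" for f s t
  proof -
    from that obtain a b V W a' b' V' W' where
      *: "pos_laurent_support x a V" "pos_laurent_support x b W" "f = a / b" "s = trop_value r V - trop_value r W"
       "pos_laurent_support x a' V'" "pos_laurent_support x b' W'" "f = a' / b'" "t = trop_value r V' - trop_value r W'"
      unfolding R_def by metis
    have "b \<noteq> 0" "b' \<noteq> 0" using * pos_laurent_support_nonzero[OF free] by auto
    hence "a * b' = a' * b" using *(3,7) by (simp add: field_simps)
    \<comment> \<open>The cross-multiplied equation gives one element two supports, so the two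
      sumsets coincide.\<close>
    hence "(\<lambda>(v, w). v + w) ` (V \<times> W') = (\<lambda>(v, w). v + w) ` (V' \<times> W)"
      using laurent_support_unique[OF free] pos_laurent_support_imp
        mult[OF *(1,6)] mult[OF *(5,2)] by metis
    hence "trop_value r V + trop_value r W' = trop_value r V' + trop_value r W"
      using trop_mult *(1,2,5,6) by metis
    thus ?thesis using * by simp
  qed
  \<comment> \<open>Away from quotients of positive Laurent polynomials this is an arbitrary
    integer.\<close>
  define \<beta> where "\<beta> f = (SOME t. R f t)" for f
  have \<beta>_eq: "\<beta> f = t" if "R f t" for f t
    unfolding \<beta>_def using that uniq by (metis someI)
  have R_\<beta>: "R f (\<beta> f)" if "f \<in> subtraction_free x" for f
    using subtraction_free_fraction[OF free that] \<beta>_eq unfolding R_def by metis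
  have R_mult: "R (f * g) (s + t)" if "R f s" "R g t" for f g s t
  proof -
    from that obtain a b V W a' b' V' W' where
      *: "pos_laurent_support x a V" "pos_laurent_support x b W" "f = a / b" "s = trop_value r V - trop_value r W"
       "pos_laurent_support x a' V'" "pos_laurent_support x b' W'" "g = a' / b'" "t = trop_value r V' - trop_value r W'"
      unfolding R_def by metis
    show ?thesis unfolding R_def
      by (rule exI[of _ "a * a'"], rule exI[of _ "b * b'"], (rule exI)+, intro conjI,
          rule mult[OF *(1,5)], rule mult[OF *(2,6)])
        (auto simp: * trop_mult[OF *(1,5)] trop_mult[OF *(2,6)])
  qed
  have R_add: "R (f + g) (max s t)" if "R f s" "R g t" for f g s t
  proof -
    from that obtain a b V W a' b' V' W' where
      *: "pos_laurent_support x a V" "pos_laurent_support x b W" "f = a / b" "s = trop_value r V - trop_value r W"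
       "pos_laurent_support x a' V'" "pos_laurent_support x b' W'" "g = a' / b'" "t = trop_value r V' - trop_value r W'"
      unfolding R_def by metis
    have "b \<noteq> 0" "b' \<noteq> 0" using * pos_laurent_support_nonzero[OF free] by auto
    hence eq: "f + g = (a * b' + a' * b) / (b * b')" using * by (metis add_frac_eq)
    show ?thesis unfolding R_def eq
      by (rule exI[of _ "a * b' + a' * b"], rule exI[of _ "b * b'"], (rule exI)+, intro conjI,
          rule pos_laurent_support_add[OF mult[OF *(1,6)] mult[OF *(5,2)]], rule mult[OF *(2,6)])
        (auto simp: *(4,8) trop_add[OF mult[OF *(1,6)] mult[OF *(5,2)]]
           trop_mult[OF *(1,6)] trop_mult[OF *(5,2)] trop_mult[OF *(2,6)])
  qed
  show thesis
  proof
    show "max_semifield_hom (subtraction_free x) \<beta>"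
      unfolding max_semifield_hom_def using R_\<beta> R_mult R_add \<beta>_eq by metis
    fix i assume i: "i < dim_vec x"
    have "R (x $ i) (r $ i)" unfolding R_def
      using pos_laurent_support_var[OF i] pos_laurent_support_const[of 1 x] i r
      by (intro exI[of _ "x $ i"] exI[of _ 1] exI[of _ "{unit_vec (dim_vec x) i}"] exI[of _ "{0\<^sub>v (dim_vec x)}"])
        (auto simp: trop_value_def)
    thus "\<beta> (x $ i) = r $ i" by (rule \<beta>_eq)
  qed
qed

text \<open>Stated for an arbitrary vector \<open>y\<close> over the semifield of \<open>x\<close>,
  so that it covers the clusters at all vertices.\<close>

lemma lmono_subtraction_free:
  assumes "\<And>i. i < dim_vec y \<Longrightarrow> y $ i \<in> subtraction_free x"
  shows "lmono y v \<in> subtraction_free x"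
proof -
  have one: "1 \<in> subtraction_free x" using subtraction_free.rat[of 1 x] by simp
  have pow: "a ^ k \<in> subtraction_free x" if "a \<in> subtraction_free x" for a k
    by (induction k) (auto simp: one that subtraction_free.mult)
  have powi: "a powi k \<in> subtraction_free x" if "a \<in> subtraction_free x" for a k
    using pow[OF that] subtraction_free.div[OF one pow[OF that]]
    by (auto simp: power_int_def inverse_eq_divide power_one_over)
  have "(\<Prod>j\<in>J. y $ j powi (v $ j)) \<in> subtraction_free x" if "finite J" "J \<subseteq> {..<dim_vec y}" for J
    using that by (induction J rule: finite_induct) (auto simp: one assms powi subtraction_free.mult)
  thus ?thesis by (simp add: lmono_def)
qed

section \<open>Values of a fixed max-plus homomorphism\<close>

context
  fixes x :: "'a::field_char_0 vec" and \<beta> :: "'a \<Rightarrow> int"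
  assumes free: "free_generating_set x" and hom: "max_semifield_hom (subtraction_free x) \<beta>"
begin

lemma hom_mult: "a \<in> subtraction_free x \<Longrightarrow> b \<in> subtraction_free x \<Longrightarrow> \<beta> (a * b) = \<beta> a + \<beta> b"
  using hom by (auto simp: max_semifield_hom_def)

lemma hom_add: "a \<in> subtraction_free x \<Longrightarrow> b \<in> subtraction_free x \<Longrightarrow> \<beta> (a + b) = max (\<beta> a) (\<beta> b)"
  using hom by (auto simp: max_semifield_hom_def)

text \<open>The definition of a homomorphism speaks of products and sums only; division follows from
  \<open>a / b * b = a\<close>.\<close>

lemma hom_div:
  assumes "a \<in> subtraction_free x" "b \<in> subtraction_free x"
  shows "\<beta> (a / b) = \<beta> a - \<beta> b"
proof -
  have "\<beta> (a / b * b) = \<beta> (a / b) + \<beta> b" using assms by (intro hom_mult subtraction_free.div)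
  moreover have "a / b * b = a" using subtraction_free_nonzero[OF free assms(2)] by simp
  ultimately show ?thesis by simp
qed

lemma one_subtraction_free: "1 \<in> subtraction_free x"
  using subtraction_free.rat[of 1 x] by simp

lemma hom_one: "\<beta> 1 = 0"
  using hom_div[OF one_subtraction_free one_subtraction_free] by simp

text \<open>Since \<open>max\<close> is idempotent, every sum of ones has the value of
  \<open>1\<close>, which is \<open>0\<close>; quotients follow. Positive coefficients are therefore
  invisible to \<open>\<beta>\<close>.\<close>

lemma hom_of_rat:
  assumes "0 < q"
  shows "\<beta> (of_rat q) = 0"
proof -
  have nat: "of_nat (Suc k) \<in> subtraction_free x \<and> \<beta> (of_nat (Suc k)) = 0" for k
  proof (induction k)
    case 0
    show ?case using one_subtraction_free hom_one by simp
  next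
    case (Suc k)
    have "of_nat (Suc (Suc k)) = of_nat (Suc k) + (1 :: 'a)" by simp
    thus ?case using Suc subtraction_free.add[OF _ one_subtraction_free] hom_add[OF _ one_subtraction_free] hom_one
      by (metis max.idem)
  qed
  obtain a b where q: "quotient_of q = (a, b)" by fastforce
  have b: "b > 0" using quotient_of_denom_pos[OF q] .
  have qab: "q = of_int a / of_int b" using quotient_of_div[OF q] .
  with assms b have a: "a > 0" by (simp add: zero_less_divide_iff)
  have ai: "of_int a = (of_nat (Suc (nat a - 1)) :: 'a)" and bi: "of_int b = (of_nat (Suc (nat b - 1)) :: 'a)"
    using a b by simp_all
  have "(of_rat q :: 'a) = of_int a / of_int b" unfolding qab by (simp add: of_rat_divide)
  thus ?thesis using nat hom_div unfolding ai bi by (metis diff_0_right)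
qed

lemma hom_powi:
  assumes "a \<in> subtraction_free x"
  shows "\<beta> (a powi k) = k * \<beta> a"
proof -
  have pow: "a ^ j \<in> subtraction_free x \<and> \<beta> (a ^ j) = int j * \<beta> a" for j
    by (induction j) (auto simp: one_subtraction_free hom_one hom_mult assms subtraction_free.mult algebra_simps)
  show ?thesis
  proof (cases "k \<ge> 0")
    case True
    thus ?thesis using pow by (simp add: power_int_def)
  next
    case False
    hence "a powi k = 1 / a ^ nat (- k)" by (simp add: power_int_def field_simps)
    thus ?thesis using False pow hom_div[OF one_subtraction_free] hom_one by simp
  qed
qed

lemma hom_lmono:
  assumes "\<And>i. i < dim_vec y \<Longrightarrow> y $ i \<in> subtraction_free x"
  shows "\<beta> (lmono y v) = (\<Sum>j<dim_vec y. v $ j * \<beta> (y $ j))"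
proof -
  \<comment> \<open>Integer powers are the Laurent monomials in a vector with one entry.\<close>
  have powi: "a powi k \<in> subtraction_free x" if "a \<in> subtraction_free x" for a k
    using lmono_subtraction_free[of "vec 1 (\<lambda>_. a)" x "vec 1 (\<lambda>_. k)"] that by (simp add: lmono_def)
  have "(\<Prod>j\<in>J. y $ j powi (v $ j)) \<in> subtraction_free x \<and>
      \<beta> (\<Prod>j\<in>J. y $ j powi (v $ j)) = (\<Sum>j\<in>J. v $ j * \<beta> (y $ j))"
    if "finite J" "J \<subseteq> {..<dim_vec y}" for J
    using that by (induction J rule: finite_induct)
      (auto simp: one_subtraction_free hom_one hom_mult hom_powi assms powi subtraction_free.mult)
  thus ?thesis by (simp add: lmono_def)
qed

lemma hom_sum:
  assumes "finite V" "V \<noteq> {}" "\<And>v. v \<in> V \<Longrightarrow> f v \<in> subtraction_free x"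
  shows "(\<Sum>v\<in>V. f v) \<in> subtraction_free x \<and> \<beta> (\<Sum>v\<in>V. f v) = Max ((\<lambda>v. \<beta> (f v)) ` V)"
  using assms
  by (induction V rule: finite_ne_induct) (auto simp: hom_add subtraction_free.add)

text \<open>Coefficients have value \<open>0\<close>, monomials have linear values, and sums become
  maxima. The cluster \<open>y\<close> may differ from the cluster \<open>x\<close> that generates
  the semifield.\<close>

lemma hom_pos_laurent_support:
  assumes y: "\<And>i. i < dim_vec y \<Longrightarrow> y $ i \<in> subtraction_free x" and f: "pos_laurent_support y f V"
  shows "f \<in> subtraction_free x" "\<beta> f = trop_value (map_vec \<beta> y) V"
proof -
  from f obtain c where V: "finite V" "V \<noteq> {}" "V \<subseteq> carrier_vec (dim_vec y)"
    and c: "\<forall>v\<in>V. c v > 0" "f = (\<Sum>v\<in>V. of_rat (c v) * lmono y v)"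
    unfolding pos_laurent_support_def by blast
  have mem: "of_rat (c v) * lmono y v \<in> subtraction_free x" if "v \<in> V" for v
    using that c(1) by (intro subtraction_free.mult subtraction_free.rat lmono_subtraction_free y) auto
  have val: "\<beta> (of_rat (c v) * lmono y v) = v \<bullet> map_vec \<beta> y" if "v \<in> V" for v
    using that c(1) by (subst hom_mult)
      (auto intro!: subtraction_free.rat lmono_subtraction_free y sum.cong
        simp: hom_of_rat hom_lmono y scalar_prod_def lessThan_atLeast0)
  show "f \<in> subtraction_free x" "\<beta> f = trop_value (map_vec \<beta> y) V"
    using hom_sum[OF V(1,2) mem] val unfolding c(2) trop_value_def by (auto cong: image_cong)
qed

end

text \<open>Subtraction-free elements are built from entries of \<open>x\<close> and positive
  rationals, and both homomorphisms send the latter to \<open>0\<close>.\<close>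

lemma max_semifield_hom_unique:
  assumes free: "free_generating_set x"
    and "max_semifield_hom (subtraction_free x) \<beta>" "max_semifield_hom (subtraction_free x) \<gamma>"
    and eq: "\<And>i. i < dim_vec x \<Longrightarrow> \<beta> (x $ i) = \<gamma> (x $ i)"
    and "f \<in> subtraction_free x"
  shows "\<beta> f = \<gamma> f"
  using assms(5)
  by induction (use assms(1-4) in \<open>auto simp: hom_of_rat hom_mult hom_add hom_div\<close>)

section \<open>Mutation of the vectors \<open>\<Lambda> g\<close>\<close>

lemma skew_symmetric_entry:
  assumes "skew_symmetric A" "A \<in> carrier_mat m m" "i < m" "j < m"
  shows "A $$ (i, j) = - A $$ (j, i)"
proof -
  have "transpose_mat A $$ (j, i) = (- A) $$ (j, i)" using assms(1) by (simp add: skew_symmetric_def)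
  thus ?thesis using assms by auto
qed

lemma skew_symmetric_scalar_prod:
  fixes A :: "int mat"
  assumes "skew_symmetric A" "A \<in> carrier_mat m m" "v \<in> carrier_vec m" "w \<in> carrier_vec m"
  shows "v \<bullet> (A *\<^sub>v w) = - (w \<bullet> (A *\<^sub>v v))"
proof -
  have "v \<bullet> (A *\<^sub>v w) = (\<Sum>i<m. \<Sum>j<m. v $ i * (A $$ (i, j) * w $ j))"
    using assms by (auto simp: scalar_prod_def lessThan_atLeast0 sum_distrib_left)
  also have "\<dots> = (\<Sum>j<m. \<Sum>i<m. v $ i * (A $$ (i, j) * w $ j))" by (rule sum.swap)
  also have "\<dots> = (\<Sum>j<m. \<Sum>i<m. - (w $ j * (A $$ (j, i) * v $ i)))"
  proof (intro sum.cong refl)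
    fix i j assume "i \<in> {..<m}" "j \<in> {..<m}"
    thus "v $ i * (A $$ (i, j) * w $ j) = - (w $ j * (A $$ (j, i) * v $ i))"
      using skew_symmetric_entry[OF assms(1,2), of i j] by simp
  qed
  also have "\<dots> = - (w \<bullet> (A *\<^sub>v v))"
    using assms by (auto simp: scalar_prod_def lessThan_atLeast0 sum_distrib_left sum_negf)
  finally show ?thesis .
qed

text \<open>The diagonal of the skew-symmetric product has entries
  \<open>S $$ (k, k) * B $$ (k, k)\<close>; these vanish, and the first factor is positive.\<close>

lemma mutation_matrix_diagonal:
  assumes "mutation_matrix m n B" "k < n" "n \<le> m"
  shows "B $$ (k, k) = 0"
proof -
  from assms(1) obtain S where S: "pos_diagonal n S"
    "skew_symmetric (S * mat n n (\<lambda>(i, j). B $$ (i, j)))" by (auto simp: mutation_matrix_def)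
  let ?A = "S * mat n n (\<lambda>(i, j). B $$ (i, j))"
  have A: "?A \<in> carrier_mat n n" using S by (auto simp: pos_diagonal_def)
  have "?A $$ (k, k) = (\<Sum>j<n. S $$ (k, j) * B $$ (j, k))"
    using S assms by (auto simp: pos_diagonal_def scalar_prod_def lessThan_atLeast0)
  also have "\<dots> = (\<Sum>j<n. if j = k then S $$ (k, k) * B $$ (k, k) else 0)"
    using S assms(2) by (intro sum.cong) (auto simp: pos_diagonal_def diagonal_mat_def)
  also have "\<dots> = S $$ (k, k) * B $$ (k, k)" using assms by simp
  finally have "S $$ (k, k) * B $$ (k, k) = 0" using skew_symmetric_entry[OF S(2) A, of k k] assms by simp
  thus ?thesis using S assms by (auto simp: pos_diagonal_def)
qed

section \<open>Consequences of compatibility for a single pair\<close>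

context
  fixes m n S B \<Lambda>
  assumes pair: "compatible_pair m n S B \<Lambda>" and nm: "n \<le> m"
begin

lemma compatible_pair_carrier:
  "S \<in> carrier_mat n n" "B \<in> carrier_mat m n" "\<Lambda> \<in> carrier_mat m m" "skew_symmetric \<Lambda>"
  using pair by (auto simp: compatible_pair_def mutation_matrix_def pos_diagonal_def)

lemma compatible_pair_entry:
  assumes "k < n" "i < m"
  shows "(\<Sum>j<m. B $$ (j, k) * \<Lambda> $$ (j, i)) = (if i = k then S $$ (k, k) else 0)"
proof -
  have "(transpose_mat B * \<Lambda>) $$ (k, i) = pad_zero m S $$ (k, i)"
    using pair by (simp add: compatible_pair_def)
  thus ?thesis using assms compatible_pair_carrier pair
    by (auto simp: pad_zero_def scalar_prod_def lessThan_atLeast0 compatible_pair_def pos_diagonal_def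
        diagonal_mat_def split: if_splits)
qed

text \<open>The transpose of the compatibility relation, as \<open>\<Lambda>\<close> is
  skew-symmetric. Shifting a vector by a multiple of column \<open>k\<close> of \<open>B\<close>
  thus alters only coordinate \<open>k\<close> of its image under \<open>\<Lambda>\<close>.\<close>

lemma Lambda_mult_col:
  assumes "k < n"
  shows "\<Lambda> *\<^sub>v col B k = - S $$ (k, k) \<cdot>\<^sub>v unit_vec m k"
proof (rule eq_vecI)
  fix i assume "i < dim_vec (- S $$ (k, k) \<cdot>\<^sub>v unit_vec m k)"
  hence i: "i < m" by simp
  have "(\<Lambda> *\<^sub>v col B k) $ i = (\<Sum>j<m. - (B $$ (j, k) * \<Lambda> $$ (j, i)))"
    using i assms compatible_pair_carrier
    by (auto simp: scalar_prod_def lessThan_atLeast0 skew_symmetric_entry[of \<Lambda> m i] intro!: sum.cong)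
  also have "\<dots> = - (if i = k then S $$ (k, k) else 0)"
    using compatible_pair_entry[OF assms i] by (simp add: sum_negf)
  finally show "(\<Lambda> *\<^sub>v col B k) $ i = (- S $$ (k, k) \<cdot>\<^sub>v unit_vec m k) $ i"
    using i by (simp add: unit_vec_def)
qed (use compatible_pair_carrier in auto)

text \<open>If the cluster variables have the values \<open>\<Lambda> *\<^sub>v g\<close>, the
  left-hand side is the value of entry \<open>k\<close> of \<open>yhat\<close>.\<close>

lemma compatible_pair_mult:
  assumes "k < n" "g \<in> carrier_vec m"
  shows "(\<Sum>j<m. B $$ (j, k) * (\<Lambda> *\<^sub>v g) $ j) = S $$ (k, k) * g $ k"
proof -
  have "(\<Sum>j<m. B $$ (j, k) * (\<Lambda> *\<^sub>v g) $ j) = col B k \<bullet> (\<Lambda> *\<^sub>v g)"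
    using assms compatible_pair_carrier by (auto simp: scalar_prod_def[of "col B k"] lessThan_atLeast0)
  also have "\<dots> = - (g \<bullet> (\<Lambda> *\<^sub>v col B k))"
    using assms compatible_pair_carrier by (intro skew_symmetric_scalar_prod) auto
  also have "\<dots> = S $$ (k, k) * g $ k"
    using assms nm by (simp add: Lambda_mult_col)
  finally show ?thesis .
qed

text \<open>The right-hand side is the exchange relation read in the max-plus semifield, with
  \<open>\<Lambda> *\<^sub>v g\<close> as the values of the cluster variables. The proof follows
  \<open>g'\<close> through the three factors of \<open>\<Lambda>'\<close>: first \<open>E\<close>,
  then \<open>\<Lambda>\<close>, then the transpose of \<open>E\<close>.\<close>

lemma Lambda_mutation_mult:
  assumes k: "k < n" and g: "g \<in> carrier_vec m" "g' \<in> carrier_vec m"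
    and mut: "Lambda_mutation k B \<Lambda> \<Lambda>'"
    and gk: "g' $ k = - (g $ k)"
    and gi: "\<And>i. i < m \<Longrightarrow> i \<noteq> k \<Longrightarrow>
      g' $ i = g $ i + pos_part (- (B $$ (i, k))) * g $ k + B $$ (i, k) * pos_part (g $ k)"
    and i: "i < m"
  shows "(\<Lambda>' *\<^sub>v g') $ i = (if i = k then
      max (\<Sum>j<m. pos_part (B $$ (j, k)) * (\<Lambda> *\<^sub>v g) $ j) (\<Sum>j<m. pos_part (- (B $$ (j, k))) * (\<Lambda> *\<^sub>v g) $ j)
        - (\<Lambda> *\<^sub>v g) $ k
    else (\<Lambda> *\<^sub>v g) $ i)"
proof -
  note car = compatible_pair_carrier
  from mut obtain \<epsilon> :: int where \<epsilon>: "\<epsilon> = 1 \<or> \<epsilon> = -1"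
    and \<Lambda>': "\<Lambda>' = transpose_mat (mutation_E \<epsilon> k B) * \<Lambda> * mutation_E \<epsilon> k B"
    by (auto simp: Lambda_mutation_def)
  define E where "E = mutation_E \<epsilon> k B"
  have E: "E \<in> carrier_mat m m" using car by (auto simp: E_def mutation_E_def)
  have E_entry: "E $$ (i, j) = (if j = k then (if i = k then - 1 else pos_part (- \<epsilon> * B $$ (i, k)))
      else (if i = j then 1 else 0))" if "i < m" "j < m" for i j
    using that car by (simp add: E_def mutation_E_def)
  have km: "k < m" using k nm by simp
  have Bkk: "B $$ (k, k) = 0"
    using pair k nm by (auto simp: compatible_pair_def intro: mutation_matrix_diagonal)
  txt \<open>\<open>E g' = g\<close> for the sign \<open>\<epsilon>\<close> adapted to \<open>g $ k\<close>; the other sign adds a multiple of the \<open>k\<close>th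
    column of \<open>B\<close>, which \<open>\<Lambda>\<close> maps to a multiple of the \<open>k\<close>th unit vector.\<close>
  define c where "c = (if \<epsilon> = 1 then pos_part (g $ k) else pos_part (- (g $ k)))"
  have "E *\<^sub>v g' = g + c \<cdot>\<^sub>v col B k"
  proof (rule eq_vecI)
    fix i assume "i < dim_vec (g + c \<cdot>\<^sub>v col B k)"
    hence i: "i < m" using car by simp
    have "(E *\<^sub>v g') $ i = (\<Sum>j<m. E $$ (i, j) * g' $ j)"
      using E g i by (auto simp: scalar_prod_def lessThan_atLeast0)
    also have "\<dots> = (\<Sum>j<m. (if j = k then E $$ (i, k) * g' $ k else 0) + (if j = i \<and> i \<noteq> k then g' $ i else 0))"
      using i km car by (intro sum.cong) (auto simp: E_entry)
    also have "\<dots> = E $$ (i, k) * g' $ k + (if i \<noteq> k then g' $ i else 0)"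
      using i km by (simp add: sum.distrib)
    also have "\<dots> = g $ i + c * B $$ (i, k)"
      using \<epsilon> i km Bkk by (auto simp: E_entry gk gi c_def max_def algebra_simps)
    finally show "(E *\<^sub>v g') $ i = (g + c \<cdot>\<^sub>v col B k) $ i" using i g car k by simp
  qed (use E car in auto)
  hence "\<Lambda> *\<^sub>v (E *\<^sub>v g') = \<Lambda> *\<^sub>v g + c \<cdot>\<^sub>v (\<Lambda> *\<^sub>v col B k)"
    using car g by (auto simp: mult_add_distrib_mat_vec[of _ m m] intro!: eq_vecI)
  hence y: "(\<Lambda> *\<^sub>v (E *\<^sub>v g')) $ j = (\<Lambda> *\<^sub>v g) $ j - (if j = k then c * S $$ (k, k) else 0)" if "j < m" for j
    using that car k by (simp add: Lambda_mult_col unit_vec_def del: index_mult_mat_vec)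
  have "\<Lambda>' *\<^sub>v g' = transpose_mat E *\<^sub>v (\<Lambda> *\<^sub>v (E *\<^sub>v g'))"
    unfolding \<Lambda>' E_def[symmetric] using E car g
    by (auto simp: assoc_mult_mat_vec[of _ m m _ m])
  hence "(\<Lambda>' *\<^sub>v g') $ i = (\<Sum>j<m. E $$ (j, i) * (\<Lambda> *\<^sub>v (E *\<^sub>v g')) $ j)"
    using E i car by (auto simp: scalar_prod_def[of "col E i"] lessThan_atLeast0)
  also have "\<dots> = (if i = k then (\<Sum>j<m. pos_part (- \<epsilon> * B $$ (j, k)) * (\<Lambda> *\<^sub>v g) $ j) - (\<Lambda> *\<^sub>v g) $ k + c * S $$ (k, k)
     else (\<Lambda> *\<^sub>v g) $ i)"
  proof (cases "i = k")
    case False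
    \<comment> \<open>Column \<open>i\<close> of \<open>E\<close> is a unit vector here, and
      coordinate \<open>i\<close> is untouched by the correction at \<open>k\<close>.\<close>
    have "(\<Sum>j<m. E $$ (j, i) * (\<Lambda> *\<^sub>v (E *\<^sub>v g')) $ j) = (\<Sum>j<m. if j = i then (\<Lambda> *\<^sub>v g) $ i else 0)"
      using False i car by (intro sum.cong) (auto simp: y E_entry simp del: index_mult_mat_vec)
    thus ?thesis using False i by simp
  next
    case True
    \<comment> \<open>The first sum has no contribution from \<open>j = k\<close>, because
      \<open>B $$ (k, k) = 0\<close>. The entry \<open>- 1\<close> of \<open>E\<close> at
      \<open>(k, k)\<close> reverses the sign of both \<open>c * S $$ (k, k)\<close> and coordinate
      \<open>k\<close>.\<close>
    have "(\<Sum>j<m. E $$ (j, i) * (\<Lambda> *\<^sub>v (E *\<^sub>v g')) $ j)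
      = (\<Sum>j<m. pos_part (- \<epsilon> * B $$ (j, k)) * (\<Lambda> *\<^sub>v g) $ j
          + (if j = k then c * S $$ (k, k) - (\<Lambda> *\<^sub>v g) $ k else 0))"
      using True i car Bkk by (intro sum.cong) (auto simp: y E_entry simp del: index_mult_mat_vec)
    thus ?thesis using True i by (simp add: sum.distrib)
  qed
  also have "\<dots> = (if i = k then
      max (\<Sum>j<m. pos_part (B $$ (j, k)) * (\<Lambda> *\<^sub>v g) $ j) (\<Sum>j<m. pos_part (- (B $$ (j, k))) * (\<Lambda> *\<^sub>v g) $ j)
        - (\<Lambda> *\<^sub>v g) $ k
    else (\<Lambda> *\<^sub>v g) $ i)"
  proof -
    define P where "P = (\<Sum>j<m. pos_part (B $$ (j, k)) * (\<Lambda> *\<^sub>v g) $ j)"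
    define Q where "Q = (\<Sum>j<m. pos_part (- (B $$ (j, k))) * (\<Lambda> *\<^sub>v g) $ j)"
    \<comment> \<open>\<open>P\<close> and \<open>Q\<close> are the values of the two products in
      the exchange relation; termwise, \<open>pos_part a - pos_part (- a) = a\<close>.\<close>
    have "P - Q = (\<Sum>j<m. B $$ (j, k) * (\<Lambda> *\<^sub>v g) $ j)"
      unfolding P_def Q_def sum_subtractf[symmetric] by (intro sum.cong) (auto simp: max_def)
    also have "\<dots> = S $$ (k, k) * g $ k" by (rule compatible_pair_mult[OF k g(1)])
    finally have PQ: "P - Q = S $$ (k, k) * g $ k" .
    have "S $$ (k, k) > 0" using pair k by (auto simp: compatible_pair_def pos_diagonal_def)
    hence "max a 0 * S $$ (k, k) = max (S $$ (k, k) * a) 0" for a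
      by (simp add: max_mult_distrib_right mult.commute)
    moreover have "Q - P = S $$ (k, k) * - (g $ k)" using PQ by simp
    \<comment> \<open>Below, \<open>R\<close> is \<open>Q\<close> or \<open>P\<close> according to
      the sign, and \<open>c * S $$ (k, k)\<close> is exactly what it lacks to reach
      \<open>max P Q\<close>. So both signs give the same result.\<close>
    ultimately have "c * S $$ (k, k) = (if \<epsilon> = 1 then max (P - Q) 0 else max (Q - P) 0)"
      unfolding c_def PQ by (cases "\<epsilon> = 1") (simp_all only: if_True if_False simp_thms)
    moreover define R where "R = (\<Sum>j<m. pos_part (- \<epsilon> * B $$ (j, k)) * (\<Lambda> *\<^sub>v g) $ j)"
    have "R = (if \<epsilon> = 1 then Q else P)"
      using \<epsilon> by (auto simp: P_def Q_def R_def)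
    moreover have "b + max (a - b) 0 = max a b" for a b :: int by simp
    ultimately have "R + c * S $$ (k, k) = max P Q"
      by (cases "\<epsilon> = 1") (simp_all only: if_True if_False simp_thms max.commute)
    hence "R - y + c * S $$ (k, k) = max P Q - y" for y by (simp only: diff_add_eq)
    thus ?thesis unfolding P_def[symmetric] Q_def[symmetric] R_def[symmetric] by (simp only:)
  qed
  finally show ?thesis .
qed

end

section \<open>Canonical expressions\<close>

definition exponent_vec :: "nat \<Rightarrow> (nat \<Rightarrow>\<^sub>0 nat) \<Rightarrow> int vec" where
  "exponent_vec n v = vec n (\<lambda>i. int (Poly_Mapping.lookup v i))"

lemma exponent_vec_carrier [simp]: "exponent_vec n v \<in> carrier_vec n"
  by (simp add: exponent_vec_def)

lemma exponent_vec_inject: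
  assumes "Poly_Mapping.keys v \<subseteq> {..<n}" "Poly_Mapping.keys w \<subseteq> {..<n}" "exponent_vec n v = exponent_vec n w"
  shows "v = w"
proof (rule poly_mapping_eqI)
  fix i
  show "Poly_Mapping.lookup v i = Poly_Mapping.lookup w i"
  proof (cases "i < n")
    case True
    have "exponent_vec n v $ i = exponent_vec n w $ i" using assms(3) by simp
    thus ?thesis using True by (simp add: exponent_vec_def)
  next
    case False
    hence "i \<notin> Poly_Mapping.keys v" "i \<notin> Poly_Mapping.keys w" using assms by auto
    thus ?thesis by (simp add: in_keys_iff)
  qed
qed

lemma power_int_sum:
  fixes a :: "'a::field"
  assumes "a \<noteq> 0"
  shows "a powi (\<Sum>i\<in>A. f i) = (\<Prod>i\<in>A. a powi f i)"
  by (induction A rule: infinite_finite_induct) (auto simp: power_int_add assms)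

lemma power_int_prod_left:
  fixes f :: "'i \<Rightarrow> 'a::field"
  shows "(\<Prod>i\<in>A. f i) powi k = (\<Prod>i\<in>A. f i powi k)"
  by (induction A rule: infinite_finite_induct) (auto simp: power_int_mult_distrib)

text \<open>Interchanging the products over \<open>i\<close> and \<open>j\<close> collects the total
  exponent of each \<open>x $ j\<close>.\<close>

lemma yhat_monomial:
  assumes nz: "\<And>i. i < dim_vec x \<Longrightarrow> x $ i \<noteq> 0" and B: "B \<in> carrier_mat (dim_vec x) n"
    and v: "Poly_Mapping.keys v \<subseteq> {..<n}"
  shows "(\<Prod>i\<in>Poly_Mapping.keys v. (yhat x B $ i) ^ Poly_Mapping.lookup v i)
    = lmono x (B *\<^sub>v exponent_vec n v)"
proof -
  let ?e = "\<lambda>i. int (Poly_Mapping.lookup v i)"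
  have "(\<Prod>i\<in>Poly_Mapping.keys v. (yhat x B $ i) ^ Poly_Mapping.lookup v i)
      = (\<Prod>i<n. (yhat x B $ i) ^ Poly_Mapping.lookup v i)"
    by (rule prod.mono_neutral_left) (use v in \<open>auto simp: in_keys_iff\<close>)
  also have "\<dots> = (\<Prod>i<n. \<Prod>j<dim_vec x. x $ j powi (B $$ (j, i) * ?e i))"
    using B by (intro prod.cong refl) (auto simp: yhat_def lmono_def power_int_prod_left power_int_mult
        simp flip: power_int_of_nat)
  also have "\<dots> = (\<Prod>j<dim_vec x. \<Prod>i<n. x $ j powi (B $$ (j, i) * ?e i))"
    by (rule prod.swap)
  also have "\<dots> = lmono x (B *\<^sub>v exponent_vec n v)" unfolding lmono_def
    using B nz by (intro prod.cong refl)
      (auto simp: power_int_sum[symmetric] scalar_prod_def exponent_vec_def lessThan_atLeast0)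
  finally show ?thesis .
qed

text \<open>Pairing \<open>B *\<^sub>v v\<close> with column \<open>k\<close> of
  \<open>\<Lambda>\<close> gives \<open>v $ k * S $$ (k, k)\<close> by compatibility, and the second
  factor is positive.\<close>

lemma compatible_pair_injective:
  assumes pair: "compatible_pair m n S B \<Lambda>" and nm: "n \<le> m"
    and v: "v \<in> carrier_vec n" and Bv: "B *\<^sub>v v = 0\<^sub>v m"
  shows "v = 0\<^sub>v n"
proof (rule eq_vecI)
  fix k assume "k < dim_vec (0\<^sub>v n :: int vec)"
  hence k: "k < n" by simp
  note car = compatible_pair_carrier[OF pair nm]
  have "0 = (\<Sum>j<m. (B *\<^sub>v v) $ j * \<Lambda> $$ (j, k))" by (simp add: Bv)
  also have "\<dots> = (\<Sum>j<m. \<Sum>i<n. v $ i * (B $$ (j, i) * \<Lambda> $$ (j, k)))"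
    using car v by (intro sum.cong refl)
      (auto simp: scalar_prod_def lessThan_atLeast0 sum_distrib_right sum_distrib_left ac_simps)
  also have "\<dots> = (\<Sum>i<n. v $ i * (\<Sum>j<m. B $$ (j, i) * \<Lambda> $$ (j, k)))"
    by (subst sum.swap) (simp add: sum_distrib_left)
  also have "\<dots> = (\<Sum>i<n. if i = k then v $ k * S $$ (k, k) else 0)"
    using k nm by (intro sum.cong refl) (auto simp: compatible_pair_entry[OF pair nm])
  also have "\<dots> = v $ k * S $$ (k, k)" using k by simp
  finally show "v $ k = 0\<^sub>v n $ k"
    using pair k by (auto simp: compatible_pair_def pos_diagonal_def)
qed (use v in simp)

section \<open>Laurent supports of pointed elements\<close>

context
  fixes m n S B \<Lambda> and x :: "'a::field_char_0 vec"
  assumes pair: "compatible_pair m n S B \<Lambda>" and nm: "n \<le> m"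
    and x: "x \<in> carrier_vec m" and free: "free_generating_set x"
begin

text \<open>A collision would put a nonzero vector in the kernel of \<open>B\<close>. Distinct terms
  of \<open>F\<close> therefore cannot cancel in the Laurent expansion.\<close>

lemma canonical_exponent_inj:
  assumes g: "g \<in> carrier_vec m" and F: "in_vars n F"
  shows "inj_on (\<lambda>v. g + B *\<^sub>v exponent_vec n v) (Poly_Mapping.keys F)"
proof (rule inj_onI)
  note B = compatible_pair_carrier(2)[OF pair nm]
  fix v w assume vw: "v \<in> Poly_Mapping.keys F" "w \<in> Poly_Mapping.keys F"
    and eq: "g + B *\<^sub>v exponent_vec n v = g + B *\<^sub>v exponent_vec n w"
  have "B *\<^sub>v exponent_vec n v = B *\<^sub>v exponent_vec n w"
  proof (rule eq_vecI)
    fix i assume i: "i < dim_vec (B *\<^sub>v exponent_vec n w)"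
    have "(g + B *\<^sub>v exponent_vec n v) $ i = (g + B *\<^sub>v exponent_vec n w) $ i" using eq by simp
    thus "(B *\<^sub>v exponent_vec n v) $ i = (B *\<^sub>v exponent_vec n w) $ i" using i B g by simp
  qed simp
  hence "B *\<^sub>v (exponent_vec n v - exponent_vec n w) = 0\<^sub>v m"
    using B by (simp add: mult_minus_distrib_mat_vec[of _ m n])
  hence "exponent_vec n v - exponent_vec n w = 0\<^sub>v n"
    by (intro compatible_pair_injective[OF pair nm]) auto
  hence "(exponent_vec n v - exponent_vec n w) $ i = 0" if "i < n" for i using that by simp
  hence "exponent_vec n v = exponent_vec n w" by (auto simp: exponent_vec_def)
  thus "v = w" using vw F by (intro exponent_vec_inject) (auto simp: in_vars_def)
qed

lemma canonical_expr_laurent_support: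
  assumes "canonical_expr x B u g F"
  shows "laurent_support x u ((\<lambda>v. g + B *\<^sub>v exponent_vec n v) ` Poly_Mapping.keys F)"
proof -
  let ?h = "\<lambda>v. g + B *\<^sub>v exponent_vec n v"
  have B: "B \<in> carrier_mat m n" by (rule compatible_pair_carrier(2)[OF pair nm])
  have g: "g \<in> carrier_vec m" and F: "in_vars n F" and u: "u = lmono x g * peval of_int (yhat x B) F"
    using assms x B by (auto simp: canonical_expr_def)
  note inj = canonical_exponent_inj[OF g F]
  \<comment> \<open>The coefficient of \<open>F\<close> at the only exponent that is sent to
    \<open>z\<close>.\<close>
  define c :: "int vec \<Rightarrow> rat" where
    "c z = of_int (Poly_Mapping.lookup F (the_inv_into (Poly_Mapping.keys F) ?h z))" for z
  have c: "c (?h v) = of_int (Poly_Mapping.lookup F v)" if "v \<in> Poly_Mapping.keys F" for v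
    unfolding c_def the_inv_into_f_f[OF inj that] ..
  have "u = (\<Sum>v\<in>Poly_Mapping.keys F. of_int (Poly_Mapping.lookup F v) * lmono x (?h v))"
    unfolding u peval_def sum_distrib_left
  proof (intro sum.cong refl)
    fix v assume v: "v \<in> Poly_Mapping.keys F"
    have "(\<Prod>i\<in>Poly_Mapping.keys v. (yhat x B $ i) ^ Poly_Mapping.lookup v i) = lmono x (B *\<^sub>v exponent_vec n v)"
      using free_generating_set_nonzero[OF free] x B v F by (intro yhat_monomial) (auto simp: in_vars_def)
    moreover have "lmono x (?h v) = lmono x g * lmono x (B *\<^sub>v exponent_vec n v)"
      using free_generating_set_nonzero[OF free] x B g by (intro lmono_add) auto
    ultimately show "lmono x g * (of_int (Poly_Mapping.lookup F v) *
        (\<Prod>i\<in>Poly_Mapping.keys v. (yhat x B $ i) ^ Poly_Mapping.lookup v i))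
      = of_int (Poly_Mapping.lookup F v) * lmono x (?h v)" by simp
  qed
  also have "\<dots> = (\<Sum>z\<in>?h ` Poly_Mapping.keys F. of_rat (c z) * lmono x z)"
    unfolding sum.reindex[OF inj] by (intro sum.cong refl) (simp add: c)
  finally have "u = (\<Sum>z\<in>?h ` Poly_Mapping.keys F. of_rat (c z) * lmono x z)" .
  thus ?thesis unfolding laurent_support_def using g B x
    by (intro conjI exI[of _ c]) (auto simp: c in_keys_iff)
qed

text \<open>The constant terms put \<open>g\<close> and \<open>g'\<close> into the common support,
  so each is the other plus \<open>B\<close> times a nonnegative vector. The two nonnegative vectors
  add up to a kernel vector of \<open>B\<close>, hence to zero, and both vanish.\<close>

lemma canonical_expr_g_unique:
  assumes u: "canonical_expr x B u g F" "canonical_expr x B u g' F'"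
  shows "g = g'"
proof -
  note B = compatible_pair_carrier(2)[OF pair nm]
  have g: "g \<in> carrier_vec m" "g' \<in> carrier_vec m"
    and 0: "0 \<in> Poly_Mapping.keys F" "0 \<in> Poly_Mapping.keys F'"
    using u x by (auto simp: canonical_expr_def in_keys_iff)
  have e0: "exponent_vec n 0 = 0\<^sub>v n" by (auto simp: exponent_vec_def)
  have B0: "B *\<^sub>v 0\<^sub>v n = 0\<^sub>v m" using B by auto
  have "(\<lambda>v. g + B *\<^sub>v exponent_vec n v) ` Poly_Mapping.keys F
      = (\<lambda>v. g' + B *\<^sub>v exponent_vec n v) ` Poly_Mapping.keys F'" (is "?V = ?V'")
    using laurent_support_unique[OF free] canonical_expr_laurent_support u by blast
  moreover have "g \<in> ?V" "g' \<in> ?V'"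
    using 0 g by (auto intro!: image_eqI[of _ _ 0] simp: e0 B0)
  ultimately obtain v w where v: "g = g' + B *\<^sub>v exponent_vec n v" and w: "g' = g + B *\<^sub>v exponent_vec n w"
    by blast
  have "B *\<^sub>v (exponent_vec n v + exponent_vec n w) = 0\<^sub>v m"
  proof (rule eq_vecI)
    fix i assume i: "i < dim_vec (0\<^sub>v m :: int vec)"
    have "g $ i = g' $ i + (B *\<^sub>v exponent_vec n v) $ i" "g' $ i = g $ i + (B *\<^sub>v exponent_vec n w) $ i"
      using arg_cong[OF v, of "\<lambda>a. a $ i"] arg_cong[OF w, of "\<lambda>a. a $ i"] i B g
      by (auto simp del: index_mult_mat_vec)
    thus "(B *\<^sub>v (exponent_vec n v + exponent_vec n w)) $ i = 0\<^sub>v m $ i"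
      using i B by (simp add: mult_add_distrib_mat_vec[of _ m n] del: index_mult_mat_vec)
  qed (use B in simp)
  hence "exponent_vec n v + exponent_vec n w = 0\<^sub>v n"
    by (intro compatible_pair_injective[OF pair nm]) auto
  hence "(exponent_vec n v + exponent_vec n w) $ i = 0" if "i < n" for i using that by simp
  hence "Poly_Mapping.lookup v i = 0" if "i < n" for i using that by (fastforce simp: exponent_vec_def)
  hence "exponent_vec n v = 0\<^sub>v n" by (auto simp: exponent_vec_def)
  thus ?thesis using v B0 g by simp
qed

lemma g_vector_eq:
  assumes "canonical_expr x B u g F"
  shows "g_vector x B u = g"
  unfolding g_vector_def using assms canonical_expr_g_unique by blast

text \<open>After its zero coefficients are dropped, the nonnegative expansion has the same support
  as the canonical expression, by uniqueness. Positivity comes from that expansion; nothing is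
  assumed about the signs in \<open>F\<close>.\<close>

lemma canonical_expr_pos_laurent_support:
  assumes u: "canonical_expr x B u g F" "u \<in> laurent_nonneg x"
  shows "pos_laurent_support x u ((\<lambda>v. g + B *\<^sub>v exponent_vec n v) ` Poly_Mapping.keys F)"
proof -
  let ?V = "(\<lambda>v. g + B *\<^sub>v exponent_vec n v) ` Poly_Mapping.keys F"
  from u(2) obtain W c where W: "finite W" "W \<subseteq> carrier_vec (dim_vec x)" "\<forall>v\<in>W. c v \<ge> 0"
    and uW: "u = (\<Sum>v\<in>W. of_int (c v) * lmono x v)"
    unfolding laurent_nonneg_def by blast
  define W' where "W' = {v \<in> W. c v > 0}"
  have "u = (\<Sum>v\<in>W'. of_rat (rat_of_int (c v)) * lmono x v)" unfolding uW
    using W by (intro sum.mono_neutral_cong_right) (force simp: W'_def)+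
  hence uW': "\<exists>c :: int vec \<Rightarrow> rat. (\<forall>v\<in>W'. c v > 0) \<and> u = (\<Sum>v\<in>W'. of_rat (c v) * lmono x v)"
    by (intro exI[of _ "\<lambda>v. of_int (c v)"]) (auto simp: W'_def)
  have fin: "finite W'" "W' \<subseteq> carrier_vec (dim_vec x)" using W by (auto simp: W'_def)
  have "laurent_support x u W'"
    unfolding laurent_support_def using fin uW' by (metis less_irrefl)
  hence "W' = ?V" using laurent_support_unique[OF free] canonical_expr_laurent_support[OF u(1)] by blast
  moreover have "0 \<in> Poly_Mapping.keys F" using u(1) by (simp add: canonical_expr_def in_keys_iff)
  ultimately show ?thesis
    unfolding pos_laurent_support_def using fin uW' by blast
qed

text \<open>Moving \<open>B\<close> across the scalar product produces \<open>(S | 0)\<close>, and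
  the contribution of \<open>g\<close> is common to all exponents, so it leaves the maximum.\<close>

lemma trop_value_canonical:
  assumes u: "canonical_expr x B u g F" and g': "g' \<in> carrier_vec m"
  shows "trop_value (\<Lambda> *\<^sub>v g') ((\<lambda>v. g + B *\<^sub>v exponent_vec n v) ` Poly_Mapping.keys F)
    = g \<bullet> (\<Lambda> *\<^sub>v g') + poly_max F (pad_zero m S *\<^sub>v g')"
proof -
  note car = compatible_pair_carrier[OF pair nm]
  have g: "g \<in> carrier_vec m" and 0: "0 \<in> Poly_Mapping.keys F"
    using u x by (auto simp: canonical_expr_def in_keys_iff)
  let ?f = "\<lambda>v. \<Sum>i < n. int (Poly_Mapping.lookup v i) * (pad_zero m S *\<^sub>v g') $ i"
  have pad: "pad_zero m S *\<^sub>v g' = transpose_mat B *\<^sub>v (\<Lambda> *\<^sub>v g')"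
    using pair car g' by (auto simp: compatible_pair_def assoc_mult_mat_vec[of _ n m _ m, symmetric])
  have "(g + B *\<^sub>v exponent_vec n v) \<bullet> (\<Lambda> *\<^sub>v g') = ?f v + g \<bullet> (\<Lambda> *\<^sub>v g')" for v
  proof -
    have "(B *\<^sub>v exponent_vec n v) \<bullet> (\<Lambda> *\<^sub>v g') = (pad_zero m S *\<^sub>v g') \<bullet> exponent_vec n v"
      unfolding pad using car g'
      by (subst transpose_vec_mult_scalar[of _ m n]) (auto intro: comm_scalar_prod[of _ m])
    also have "\<dots> = ?f v"
      by (simp add: scalar_prod_def exponent_vec_def lessThan_atLeast0 mult.commute del: index_mult_mat_vec)
    finally show ?thesis using g g' car by (subst add_scalar_prod_distrib[of _ m]) auto
  qed
  hence "trop_value (\<Lambda> *\<^sub>v g') ((\<lambda>v. g + B *\<^sub>v exponent_vec n v) ` Poly_Mapping.keys F)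
    = Max ((\<lambda>v. ?f v + g \<bullet> (\<Lambda> *\<^sub>v g')) ` Poly_Mapping.keys F)"
    unfolding trop_value_def image_image by simp
  also have "\<dots> = Max (?f ` Poly_Mapping.keys F) + g \<bullet> (\<Lambda> *\<^sub>v g')"
    using 0 by (intro Max_add_commute) auto
  also have "Max (?f ` Poly_Mapping.keys F) = poly_max F (pad_zero m S *\<^sub>v g')"
    using car by (simp add: poly_max_def pad_zero_def)
  finally show ?thesis by simp
qed

end

text \<open>The exponent \<open>0\<close> contributes the value \<open>0\<close> to the
  maximum.\<close>

lemma poly_max_nonneg:
  assumes "Poly_Mapping.lookup F 0 \<noteq> 0"
  shows "poly_max F r \<ge> 0"
proof -
  have "0 \<in> Poly_Mapping.keys F" using assms by (simp add: in_keys_iff)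
  thus ?thesis unfolding poly_max_def by (intro Max_ge) (auto intro!: image_eqI[of _ _ 0])
qed

lemma poly_max_one: "poly_max 1 r = 0"
  by (simp add: poly_max_def)

lemma canonical_expr_lmono:
  "v \<in> carrier_vec (dim_vec x) \<Longrightarrow> canonical_expr x B (lmono x v) v 1"
  by (simp add: canonical_expr_def in_vars_def peval_def)

section \<open>Tropical points define semifield homomorphisms\<close>

context
  fixes X :: "nat list \<Rightarrow> 'a::field_char_0 vec" and B \<Lambda> :: "nat list \<Rightarrow> int mat"
    and S :: "int mat" and m n :: nat
  assumes nm: "n \<le> m" and pattern: "cluster_pattern m n X B" and struct: "Lambda_structure m n S B \<Lambda>"
begin

lemma root_tree_vertex: "[] \<in> tree_vertices n"
  by (simp add: tree_vertices_def)

lemma pattern_vertex: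
  assumes "t \<in> tree_vertices n"
  shows "X t \<in> carrier_vec m" "free_generating_set (X t)" "compatible_pair m n S (B t) (\<Lambda> t)"
  using assms pattern struct by (auto simp: cluster_pattern_def is_seed_def Lambda_structure_def)

text \<open>Induction along the path from the root: the exchange relation is subtraction-free, and
  its max-plus form is the mutation rule of \<open>Lambda_mutation_mult\<close>. Membership and
  values go together, since \<open>\<beta>\<close> respects the operations only inside the
  semifield.\<close>

lemma cluster_hom_values:
  assumes g: "tropical_point m n B g"
    and hom: "max_semifield_hom (subtraction_free (X [])) \<beta>"
    and root: "map_vec \<beta> (X []) = \<Lambda> [] *\<^sub>v g []"
    and "t \<in> tree_vertices n"
  shows "(\<forall>i<m. X t $ i \<in> subtraction_free (X [])) \<and> map_vec \<beta> (X t) = \<Lambda> t *\<^sub>v g t"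
  using assms(4)
proof (induction t)
  case Nil
  show ?case using pattern_vertex[OF root_tree_vertex] root subtraction_free.var[of _ "X []"] by (auto dest: carrier_vecD)
next
  case (Cons k s)
  note free = pattern_vertex(2)[OF root_tree_vertex]
  have s: "s \<in> tree_vertices n" and k: "k < n"
    using Cons.prems by (cases s; auto simp: tree_vertices_def)+
  have edge: "tree_edge n k s (k # s)" using s Cons.prems by (simp add: tree_edge_def)
  note pair = pattern_vertex(3)[OF s] and pair' = pattern_vertex(3)[OF Cons.prems]
  note car = compatible_pair_carrier[OF pair nm] and car' = compatible_pair_carrier[OF pair' nm]
  have Xs: "X s \<in> carrier_vec m" by (rule pattern_vertex[OF s])
  have X': "X (k # s) = mutate_cluster k (B s) (X s)" using pattern edge by (auto simp: cluster_pattern_def)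
  have sf: "X s $ i \<in> subtraction_free (X [])" if "i < dim_vec (X s)" for i
    using Cons.IH[OF s] that Xs by auto
  have val: "\<beta> (X s $ i) = (\<Lambda> s *\<^sub>v g s) $ i" if "i < m" for i
    using arg_cong[OF conjunct2[OF Cons.IH[OF s]], of "\<lambda>a. a $ i"] that Xs by (simp del: index_mult_mat_vec)
  \<comment> \<open>The exponents of the two monomials in the exchange relation.\<close>
  let ?p = "vec m (\<lambda>j. pos_part (B s $$ (j, k)))" and ?q = "vec m (\<lambda>j. pos_part (- (B s $$ (j, k))))"
  have X'k: "X (k # s) $ k = (lmono (X s) ?p + lmono (X s) ?q) / X s $ k"
    unfolding X' mutate_cluster_def lmono_def using Xs k nm by auto
  have X'i: "X (k # s) $ i = X s $ i" if "i < m" "i \<noteq> k" for i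
    unfolding X' mutate_cluster_def using that Xs by auto
  have km: "k < m" using k nm by simp
  note mem = lmono_subtraction_free[OF sf]
  have sf': "X (k # s) $ i \<in> subtraction_free (X [])" if "i < m" for i
    using that Xs k nm by (cases "i = k") (auto simp: X'k X'i intro!: subtraction_free.add subtraction_free.div mem sf)
  moreover have "\<beta> (X (k # s) $ i) = (\<Lambda> (k # s) *\<^sub>v g (k # s)) $ i" if i: "i < m" for i
  proof -
    have val_mono: "\<beta> (lmono (X s) w) = (\<Sum>j<m. w $ j * (\<Lambda> s *\<^sub>v g s) $ j)" for w
      using Xs by (subst hom_lmono[OF free hom sf]) (auto simp: val simp del: index_mult_mat_vec)
    have "\<beta> (X (k # s) $ k) = max (\<Sum>j<m. pos_part (B s $$ (j, k)) * (\<Lambda> s *\<^sub>v g s) $ j)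
        (\<Sum>j<m. pos_part (- (B s $$ (j, k))) * (\<Lambda> s *\<^sub>v g s) $ j) - (\<Lambda> s *\<^sub>v g s) $ k"
      unfolding X'k using Xs km
      by (subst hom_div[OF free hom]; (subst hom_add[OF free hom])?)
        (auto intro!: subtraction_free.add mem sf simp: val val_mono simp del: index_mult_mat_vec)
    moreover have "(\<Lambda> (k # s) *\<^sub>v g (k # s)) $ i = (if i = k then
        max (\<Sum>j<m. pos_part (B s $$ (j, k)) * (\<Lambda> s *\<^sub>v g s) $ j)
          (\<Sum>j<m. pos_part (- (B s $$ (j, k))) * (\<Lambda> s *\<^sub>v g s) $ j) - (\<Lambda> s *\<^sub>v g s) $ k
        else (\<Lambda> s *\<^sub>v g s) $ i)"
    proof (rule Lambda_mutation_mult[OF pair nm k _ _ _ _ _ i])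
      show "g s \<in> carrier_vec m" "g (k # s) \<in> carrier_vec m"
        using g s Cons.prems unfolding tropical_point_def by blast+
      show "Lambda_mutation k (B s) (\<Lambda> s) (\<Lambda> (k # s))"
        using struct edge unfolding Lambda_structure_def by blast
      show "g (k # s) $ k = - (g s $ k)"
        using g edge unfolding tropical_point_def by blast
      show "g (k # s) $ j = g s $ j + pos_part (- (B s $$ (j, k))) * g s $ k + B s $$ (j, k) * pos_part (g s $ k)"
        if "j < m" "j \<noteq> k" for j
        using g edge that unfolding tropical_point_def by blast
    qed
    ultimately show ?thesis using i by (simp add: X'i val del: index_mult_mat_vec)
  qed
  moreover have "X (k # s) \<in> carrier_vec m" by (rule pattern_vertex[OF Cons.prems])
  ultimately show ?case using car' by (auto simp del: index_mult_mat_vec intro!: eq_vecI)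
qed

text \<open>\<open>beta\<close> is a definite description, so existence and uniqueness are both
  required. A homomorphism with the right values at the root has them at all vertices, and the
  values at the root determine it.\<close>

lemma beta_spec:
  assumes tp: "tropical_point m n B (\<lambda>t. g_vector (X t) (B t) u)"
  shows "max_semifield_hom (subtraction_free (X [])) (beta n X B \<Lambda> u)"
    and "t \<in> tree_vertices n \<Longrightarrow> map_vec (beta n X B \<Lambda> u) (X t) = \<Lambda> t *\<^sub>v g_vector (X t) (B t) u"
proof -
  let ?g = "\<lambda>t. g_vector (X t) (B t) u" and ?D = "subtraction_free (X [])"
  let ?P = "\<lambda>\<beta>. \<beta> \<in> extensional ?D \<and> max_semifield_hom ?D \<beta> \<and>
     (\<forall>t \<in> tree_vertices n. map_vec \<beta> (X t) = \<Lambda> t *\<^sub>v ?g t)"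
  note root = pattern_vertex[OF root_tree_vertex]
  note car = compatible_pair_carrier[OF root(3) nm]
  have dim: "\<Lambda> [] *\<^sub>v ?g [] \<in> carrier_vec (dim_vec (X []))"
    by (rule carrier_vecI) (simp only: dim_mult_mat_vec carrier_matD(1)[OF car(3)] carrier_vecD[OF root(1)])
  obtain \<beta> where hom: "max_semifield_hom ?D \<beta>"
    and val: "\<And>i. i < dim_vec (X []) \<Longrightarrow> \<beta> (X [] $ i) = (\<Lambda> [] *\<^sub>v ?g []) $ i"
    by (rule max_semifield_hom_exists[OF root(2) dim]) blast
  \<comment> \<open>The restriction supplies the extensionality that the description asks
    for.\<close>
  define \<gamma> where "\<gamma> = restrict \<beta> ?D"
  have hom': "max_semifield_hom ?D \<gamma>"
    using hom by (auto simp: max_semifield_hom_def \<gamma>_def subtraction_free.add subtraction_free.mult)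
  have "map_vec \<gamma> (X []) = \<Lambda> [] *\<^sub>v ?g []"
    using val root(1) car by (auto simp: \<gamma>_def subtraction_free.var simp del: index_mult_mat_vec intro!: eq_vecI)
  hence "?P \<gamma>" using cluster_hom_values[OF tp hom'] hom' by (auto simp: \<gamma>_def)
  moreover have "\<delta> = \<gamma>" if "?P \<delta>" for \<delta>
  proof (rule extensionalityI)
    show "\<delta> \<in> extensional ?D" "\<gamma> \<in> extensional ?D" using that \<open>?P \<gamma>\<close> by auto
    fix f assume f: "f \<in> ?D"
    have "map_vec \<delta> (X []) = map_vec \<gamma> (X [])" using that \<open>?P \<gamma>\<close> root_tree_vertex by auto
    hence "\<delta> (X [] $ i) = \<gamma> (X [] $ i)" if "i < dim_vec (X [])" for i
      using that by (metis index_map_vec(1))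
    thus "\<delta> f = \<gamma> f" using max_semifield_hom_unique[OF root(2)] that hom' f by blast
  qed
  ultimately have "?P (beta n X B \<Lambda> u)" unfolding beta_def by (rule theI)
  thus "max_semifield_hom ?D (beta n X B \<Lambda> u)"
    and "t \<in> tree_vertices n \<Longrightarrow> map_vec (beta n X B \<Lambda> u) (X t) = \<Lambda> t *\<^sub>v ?g t" by auto
qed

text \<open>Although \<open>beta\<close> lives on the semifield of the root cluster, it is evaluated
  at \<open>u\<close> through the expansion at \<open>w\<close>: the cluster variables at
  \<open>w\<close> lie in that semifield and have the values
  \<open>\<Lambda> w *\<^sub>v g'\<close>.\<close>

lemma trop_invariant_formula:
  assumes u: "good m n X B u" "good m n X B u'" and w: "w \<in> tree_vertices n"
    and can: "canonical_expr (X w) (B w) u g F" "canonical_expr (X w) (B w) u' g' F'"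
  shows "trop_invariant n X B \<Lambda> u u' = g \<bullet> (\<Lambda> w *\<^sub>v g') + poly_max F (pad_zero m S *\<^sub>v g')"
proof -
  note pv = pattern_vertex[OF w]
  have tp: "tropical_point m n B (\<lambda>t. g_vector (X t) (B t) u')" using u by (simp add: good_def)
  note \<beta> = beta_spec[OF tp]
  have g': "g' \<in> carrier_vec m" using can(2) pv(1) by (auto simp: canonical_expr_def)
  have val: "map_vec (beta n X B \<Lambda> u') (X w) = \<Lambda> w *\<^sub>v g'"
    using \<beta>(2)[OF w] g_vector_eq[OF pv(3) nm pv(1,2) can(2)] by simp
  have sf: "X w $ i \<in> subtraction_free (X [])" if "i < dim_vec (X w)" for i
    using cluster_hom_values[OF tp \<beta>(1) \<beta>(2)[OF root_tree_vertex] w] that pv(1) by auto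
  have "u \<in> laurent_nonneg (X w)" using u(1) w unfolding good_def by blast
  note pos = canonical_expr_pos_laurent_support[OF pv(3) nm pv(1,2) can(1) this]
  have "beta n X B \<Lambda> u' u
      = trop_value (\<Lambda> w *\<^sub>v g') ((\<lambda>v. g + B w *\<^sub>v exponent_vec n v) ` Poly_Mapping.keys F)"
    unfolding val[symmetric]
    by (rule hom_pos_laurent_support(2)[OF pattern_vertex(2)[OF root_tree_vertex] \<beta>(1) sf pos])
  thus ?thesis
    unfolding trop_invariant_def using trop_value_canonical[OF pv(3) nm pv(1,2) can(1) g'] by simp
qed

text \<open>The two bilinear terms cancel because \<open>\<Lambda> w\<close> is
  skew-symmetric.\<close>

lemma F_invariant_formula:
  assumes u: "good m n X B u" "good m n X B u'" and w: "w \<in> tree_vertices n"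
    and can: "canonical_expr (X w) (B w) u g F" "canonical_expr (X w) (B w) u' g' F'"
  shows "F_invariant n X B \<Lambda> u u' = poly_max F (pad_zero m S *\<^sub>v g') + poly_max F' (pad_zero m S *\<^sub>v g)"
proof -
  note car = compatible_pair_carrier[OF pattern_vertex(3)[OF w] nm]
  have "g \<in> carrier_vec m" "g' \<in> carrier_vec m"
    using can pattern_vertex(1)[OF w] by (auto simp: canonical_expr_def)
  hence "g \<bullet> (\<Lambda> w *\<^sub>v g') = - (g' \<bullet> (\<Lambda> w *\<^sub>v g))"
    using car by (intro skew_symmetric_scalar_prod)
  thus ?thesis unfolding F_invariant_def
    using trop_invariant_formula[OF u w can] trop_invariant_formula[OF u(2,1) w can(2,1)] by simp
qed

text \<open>The invariant does not depend on the vertex at which it is computed; at a vertex whose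
  cluster contains the factors of \<open>u\<close>, the polynomial is \<open>1\<close>.\<close>

lemma F_invariant_cluster_monomial:
  assumes u: "good m n X B u" and "cluster_monomial m n X u"
  shows "F_invariant n X B \<Lambda> u u = 0"
proof -
  from assms(2) obtain t v where t: "t \<in> tree_vertices n" "v \<in> carrier_vec m" "u = lmono (X t) v"
    by (auto simp: cluster_monomial_def)
  have "canonical_expr (X t) (B t) u v 1"
    using t pattern_vertex(1)[OF t(1)] by (auto intro: canonical_expr_lmono)
  from F_invariant_formula[OF u u t(1) this this] show ?thesis by (simp add: poly_max_one)
qed

end

theorem theorem1p3:
  fixes X :: "nat list \<Rightarrow> 'a::field_char_0 vec"
    and B \<Lambda> :: "nat list \<Rightarrow> int mat"
    and S :: "int mat"
    and m n :: nat
    and u u' :: 'a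
    and w :: "nat list"
    and g g' :: "int vec"
    and F F' :: "int mpoly"
  assumes "0 < n" and "n \<le> m"
    and "cluster_pattern m n X B"
    and "Lambda_structure m n S B \<Lambda>"
    and "good m n X B u" and "good m n X B u'"
    and "w \<in> tree_vertices n"
    and "canonical_expr (X w) (B w) u g F"
    and "canonical_expr (X w) (B w) u' g' F'"
  shows "trop_invariant n X B \<Lambda> u u'
           = g \<bullet> (\<Lambda> w *\<^sub>v g') + poly_max F (pad_zero m S *\<^sub>v g')
       \<and> F_invariant n X B \<Lambda> u u'
           = poly_max F (pad_zero m S *\<^sub>v g') + poly_max F' (pad_zero m S *\<^sub>v g)
       \<and> F_invariant n X B \<Lambda> u u' \<ge> 0
       \<and> (cluster_monomial m n X u \<longrightarrow> F_invariant n X B \<Lambda> u u = 0)"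
proof (intro conjI impI)
  show eq: "F_invariant n X B \<Lambda> u u' = poly_max F (pad_zero m S *\<^sub>v g') + poly_max F' (pad_zero m S *\<^sub>v g)"
    by (rule F_invariant_formula[OF assms(2-9)])
  have "Poly_Mapping.lookup F 0 \<noteq> 0" "Poly_Mapping.lookup F' 0 \<noteq> 0"
    using assms(8,9) by (auto simp: canonical_expr_def)
  thus "F_invariant n X B \<Lambda> u u' \<ge> 0" unfolding eq by (intro add_nonneg_nonneg poly_max_nonneg)
  show "trop_invariant n X B \<Lambda> u u' = g \<bullet> (\<Lambda> w *\<^sub>v g') + poly_max F (pad_zero m S *\<^sub>v g')"
    by (rule trop_invariant_formula[OF assms(2-9)])
  show "F_invariant n X B \<Lambda> u u = 0" if "cluster_monomial m n X u"
    by (rule F_invariant_cluster_monomial[OF assms(2-5) that])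
qed

end
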